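(* Let $h_1,h_2,h_3\in\mathbb{R}$ with $h_1^2\geq h_2^2\geq h_3^2$ and $P>0$. The sum-capacity $C_N$ of the (non-restricted) Gaussian Y-channel with gains $h_1,h_2,h_3$ and power $P$ satisfies $$C_N\leq C((h_2^2+h_3^2)P)+C(\min\{h_1^2+h_3^2,(|h_2|+|h_3|)^2\}P).$$
   Context: $C(x)=\frac12\log_2(1+x)$. The (non-restricted, reciprocal) Gaussian Y-channel with real gains $h_1,h_2,h_3$ and power $P>0$: there are users $1,2,3$ and a relay $r$. For each ordered pair $(j,k)$ of distinct indices in $\{1,2,3\}$, user $j$ holds a message $m_{jk}$, uniform on $\{1,\dots,2^{nR_{jk}}\}$, intended for user $k$; the six messages are mutually independent. Over channel uses $i=1,\dots,n$, the relay receives $Y_{ri}=h_1X_{1i}+h_2X_{2i}+h_3X_{3i}+Z_{ri}$ and user $j$ receives $Y_{ji}=h_jX_{ri}+Z_{ji}$, all noise samples i.i.d. $\mathcal N(0,1)$ independent of the messages. A code of length $n$: encoders $X_{ji}=f_{ji}(m_{jk},m_{jl},Y_j^{i-1})$ ($\{k,l\}=\{1,2,3\}\setminus\{j\}$), relay encoders $X_{ri}=f_{ri}(Y_r^{i-1})$, power constraints $\frac1n\sum_i\mathbb E[X_{ai}^2]\le P$ for $a\in\{1,2,3,r\}$, and decoders by which user $j$ estimates $(m_{kj},m_{lj})$ from $(Y_j^n,m_{jk},m_{jl})$. A rate tuple $(R_{jk})_{j\ne k}$ is achievable if there exist codes whose error probability (some message decoded wrongly) tends to $0$ as $n\to\infty$.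 $C_N$ is the supremum of $\sum_{j\ne k}R_{jk}$ over achievable tuples. *)

theory Defs
  imports "HOL-Probability.Probability"
begin

definition Cap :: "real \<Rightarrow> real" where
  "Cap x = 1/2 * log 2 (1 + x)"

text \<open>Users are 1,2,3; node 0 is the relay. Time indices are 0..n-1
  (time i here corresponds to channel use i+1 in the paper).\<close>
definition users :: "nat set" where "users = {1,2,3}"

definition pairs :: "(nat \<times> nat) set" where
  "pairs = {(j,k). j \<in> users \<and> k \<in> users \<and> j \<noteq> k}"

definition gain :: "real \<Rightarrow> real \<Rightarrow> real \<Rightarrow> nat \<Rightarrow> real" where
  "gain h1 h2 h3 j = (if j = 1 then h1 else if j = 2 then h2 else h3)"

text \<open>A code: enc j i (m_j) y  is user j's input at time i, given its own messages
  m_j = (\<lambda>k. m j k) (only the entries k in users - {j} carry information, the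
  others are fixed to 1) and its past outputs y = Y_j^{i-1};
  rel i y is the relay input at time i given Y_r^{i-1};
  dec j (m_j) y is user j's estimate (\<lambda>k. estimate of m k j) from Y_j^n and its own messages.\<close>
record code =
  enc :: "nat \<Rightarrow> nat \<Rightarrow> (nat \<Rightarrow> nat) \<Rightarrow> real list \<Rightarrow> real"
  rel :: "nat \<Rightarrow> real list \<Rightarrow> real"
  dec :: "nat \<Rightarrow> (nat \<Rightarrow> nat) \<Rightarrow> real list \<Rightarrow> (nat \<Rightarrow> nat)"

text \<open>Output histories after i channel uses: hist .. i 0 = Y_r^i, hist .. i j = Y_j^i,
  driven by messages m and the noise realisation \<omega> (\<omega> (a,i) = noise at node a, time i).\<close>
primrec hist :: "real \<Rightarrow> real \<Rightarrow> real \<Rightarrow> code \<Rightarrow> (nat \<Rightarrow> nat \<Rightarrow> nat) \<Rightarrow> (nat \<times> nat \<Rightarrow> real)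
                  \<Rightarrow> nat \<Rightarrow> nat \<Rightarrow> real list" where
  "hist h1 h2 h3 c m \<omega> 0 = (\<lambda>a. [])"
| "hist h1 h2 h3 c m \<omega> (Suc i) =
     (let H = hist h1 h2 h3 c m \<omega> i;
          xr = rel c i (H 0)
      in (\<lambda>a. if a = 0 then
                 H 0 @ [(\<Sum>j\<in>users. gain h1 h2 h3 j * enc c j i (m j) (H j)) + \<omega> (0, i)]
               else if a \<in> users then H a @ [gain h1 h2 h3 a * xr + \<omega> (a, i)]
               else []))"

definition inp :: "real \<Rightarrow> real \<Rightarrow> real \<Rightarrow> code \<Rightarrow> (nat \<Rightarrow> nat \<Rightarrow> nat) \<Rightarrow> (nat \<times> nat \<Rightarrow> real)
                  \<Rightarrow> nat \<Rightarrow> nat \<Rightarrow> real" where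
  "inp h1 h2 h3 c m \<omega> a i =
     (if a = 0 then rel c i (hist h1 h2 h3 c m \<omega> i 0)
      else enc c a i (m a) (hist h1 h2 h3 c m \<omega> i a))"

definition nmsg :: "nat \<Rightarrow> real \<Rightarrow> nat" where
  "nmsg n r = nat \<lceil>2 powr (real n * r)\<rceil>"

definition msgs :: "nat \<Rightarrow> (nat \<Rightarrow> nat \<Rightarrow> real) \<Rightarrow> (nat \<Rightarrow> nat \<Rightarrow> nat) set" where
  "msgs n R = {m. \<forall>j k. (if (j,k) \<in> pairs then m j k \<in> {1..nmsg n (R j k)} else m j k = 1)}"

definition noise :: "nat \<Rightarrow> (nat \<times> nat \<Rightarrow> real) measure" where
  "noise n = PiM ({0..3} \<times> {..<n}) (\<lambda>_. density lborel std_normal_density)"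

definition err_event :: "real \<Rightarrow> real \<Rightarrow> real \<Rightarrow> nat \<Rightarrow> code \<Rightarrow> (nat \<Rightarrow> nat \<Rightarrow> nat)
                         \<Rightarrow> (nat \<times> nat \<Rightarrow> real) set" where
  "err_event h1 h2 h3 n c m = {\<omega> \<in> space (noise n).
      \<exists>(k,j)\<in>pairs. dec c j (m j) (hist h1 h2 h3 c m \<omega> n j) k \<noteq> m k j}"

definition perr :: "real \<Rightarrow> real \<Rightarrow> real \<Rightarrow> nat \<Rightarrow> (nat \<Rightarrow> nat \<Rightarrow> real) \<Rightarrow> code \<Rightarrow> real" where
  "perr h1 h2 h3 n R c =
     (\<Sum>m\<in>msgs n R. measure (noise n) (err_event h1 h2 h3 n c m)) / real (card (msgs n R))"

definition avg_power :: "real \<Rightarrow> real \<Rightarrow> real \<Rightarrow> nat \<Rightarrow> (nat \<Rightarrow> nat \<Rightarrow> real) \<Rightarrow> code \<Rightarrow> nat \<Rightarrow> real" where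
  "avg_power h1 h2 h3 n R c a =
     (1 / real n) * (\<Sum>i<n. (\<Sum>m\<in>msgs n R. integral\<^sup>L (noise n) (\<lambda>\<omega>. (inp h1 h2 h3 c m \<omega> a i)\<^sup>2))
                                / real (card (msgs n R)))"

definition valid_code :: "real \<Rightarrow> real \<Rightarrow> real \<Rightarrow> real \<Rightarrow> nat \<Rightarrow> (nat \<Rightarrow> nat \<Rightarrow> real) \<Rightarrow> code \<Rightarrow> bool" where
  "valid_code h1 h2 h3 P n R c \<longleftrightarrow>
     (\<forall>m\<in>msgs n R. \<forall>a\<in>{0..3}. \<forall>i<n.
        (\<lambda>\<omega>. inp h1 h2 h3 c m \<omega> a i) \<in> borel_measurable (noise n) \<and>
        integrable (noise n) (\<lambda>\<omega>. (inp h1 h2 h3 c m \<omega> a i)\<^sup>2)) \<and>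
     (\<forall>m\<in>msgs n R. err_event h1 h2 h3 n c m \<in> sets (noise n)) \<and>
     (\<forall>a\<in>{0..3}. avg_power h1 h2 h3 n R c a \<le> P)"

definition achievable :: "real \<Rightarrow> real \<Rightarrow> real \<Rightarrow> real \<Rightarrow> (nat \<Rightarrow> nat \<Rightarrow> real) \<Rightarrow> bool" where
  "achievable h1 h2 h3 P R \<longleftrightarrow>
     (\<forall>j k. R j k \<ge> 0) \<and>
     (\<exists>cs :: nat \<Rightarrow> code.
        (\<forall>n. valid_code h1 h2 h3 P n R (cs n)) \<and>
        (\<lambda>n. perr h1 h2 h3 n R (cs n)) \<longlonglongrightarrow> 0)"

definition sum_capacity :: "real \<Rightarrow> real \<Rightarrow> real \<Rightarrow> real \<Rightarrow> ereal" where
  "sum_capacity h1 h2 h3 P =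
     (SUP R \<in> {R. achievable h1 h2 h3 P R}. ereal (\<Sum>(j,k)\<in>pairs. R j k))"

end

theory Submission
  imports Defs
begin

text \<open>
  The six rates split into two triples of the form R_kj + R_lj + R_kl. A receiver that sees
  the outputs of users j and l and is told the messages of user j and m_lk decodes all three
  messages of a triple: first m_kj and m_lj as user j, then, knowing both messages of user l, also
  m_kl as user l. The broadcast bound uses just these two outputs; the multiple-access bound
  adds the relay output, from which the contribution of user j can be subtracted.

  Instead of mutual information, the converse uses a change of measure on the noise space. For
  fixed messages, the observations are a triangular shear of the noise, so their law has an
  explicit likelihood ratio exp L with respect to a product of Gaussians that does not depend on the
  messages. Since the decoding regions are disjoint, the sum over the messages of
  E[exp (-L); correct] is at most 1, and Jensen's inequality gives
  log M \<le> (E L + 1) / p - log p for success probability p. With the variances of the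
  reference Gaussians taken at full power P, E L is affine in the transmit powers, hence
  bounded by n times the claimed capacity.
\<close>

section \<open>Triangular shears of product spaces\<close>

text \<open>The observations as a function of the noise \<open>w\<close>: \<open>s t\<close> is the
  signal at coordinate \<open>t\<close>, \<open>w t\<close> the fresh noise added to it. Restricting
  to \<open>I\<close> makes the result a point of the product space.\<close>

definition shear :: "'i set \<Rightarrow> ('i \<Rightarrow> ('i \<Rightarrow> real) \<Rightarrow> real) \<Rightarrow> ('i \<Rightarrow> real) \<Rightarrow> 'i \<Rightarrow> real" where
  "shear I s w = (\<lambda>t\<in>I. s t w + w t)"

text \<open>\<open>r\<close> ranks the coordinates by time. Strictness of \<open>r u < r t\<close>
  makes the shear unit triangular; coordinates of equal rank do not influence each other. The second
  clause ranges over all functions, not only extensional ones, so that single coordinates can be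
  overwritten freely.\<close>

definition causal :: "('i \<Rightarrow> nat) \<Rightarrow> 'i set \<Rightarrow> ('i \<Rightarrow> ('i \<Rightarrow> real) \<Rightarrow> real) \<Rightarrow> bool" where
  "causal r I s \<longleftrightarrow> (\<forall>t\<in>I. s t \<in> borel_measurable (PiM I (\<lambda>_. borel)) \<and>
     (\<forall>w w'. (\<forall>u\<in>I. r u < r t \<longrightarrow> w u = w' u) \<longrightarrow> s t w = s t w'))"

lemma causal_measurable: "causal r I s \<Longrightarrow> t \<in> I \<Longrightarrow> s t \<in> borel_measurable (PiM I (\<lambda>_. borel))"
  by (simp add: causal_def)

lemma causal_cong:
  "causal r I s \<Longrightarrow> t \<in> I \<Longrightarrow> (\<And>u. u \<in> I \<Longrightarrow> r u < r t \<Longrightarrow> w u = w' u) \<Longrightarrow> s t w = s t w'"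
  unfolding causal_def by metis

lemma causal_fun_upd:
  assumes "causal r I s" "t \<in> I" "\<not> r u < r t"
  shows "s t (w(u := z)) = s t w"
  using assms by (intro causal_cong[OF assms(1,2)]) auto

lemma measurable_fun_upd_const:
  "(\<lambda>w. w(t := z)) \<in> measurable (PiM I (\<lambda>_. borel)) (PiM (insert t I) (\<lambda>_. borel :: real measure))"
  by (rule measurable_fun_upd[where J=I]) auto

text \<open>Freezing coordinate \<open>t\<close> at 0 does not change \<open>f\<close> and leaves a
  function of the other coordinates.\<close>

lemma measurable_last_coordinate:
  assumes "f \<in> borel_measurable (PiM (insert t I) (\<lambda>_. borel :: real measure))" 
    and "\<And>w z. f (w(t := z)) = f w"
  shows "f \<in> borel_measurable (PiM I (\<lambda>_. borel))"
proof -
  have "(\<lambda>w. f (w(t := 0))) \<in> borel_measurable (PiM I (\<lambda>_. borel))"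
    by (rule measurable_compose[OF measurable_fun_upd_const assms(1)])
  then show ?thesis by (simp add: assms(2))
qed

lemma causal_remove_last:
  assumes "causal r (insert t I) s" and le: "\<And>u. u \<in> I \<Longrightarrow> r u \<le> r t"
  shows "causal r I s"
  unfolding causal_def
proof (intro ballI conjI allI impI)
  fix u assume u: "u \<in> I"
  show "s u \<in> borel_measurable (PiM I (\<lambda>_. borel))"
  proof (rule measurable_last_coordinate[where t=t])
    show "s u \<in> borel_measurable (PiM (insert t I) (\<lambda>_. borel))"
      using u by (intro causal_measurable[OF assms(1)]) simp
    show "s u (w(t := z)) = s u w" for w z
      using u le[OF u] by (intro causal_fun_upd[OF assms(1)]) auto
  qed
  fix w w' :: "'a \<Rightarrow> real" assume "\<forall>v\<in>I. r v < r u \<longrightarrow> w v = w' v"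
  then show "s u w = s u w'"
    using le[OF u] u by (intro causal_cong[OF assms(1)]) auto
qed

lemma causal_last_measurable:
  assumes "causal r (insert t I) s"
  shows "s t \<in> borel_measurable (PiM I (\<lambda>_. borel))"
proof (rule measurable_last_coordinate[where t=t])
  show "s t \<in> borel_measurable (PiM (insert t I) (\<lambda>_. borel))"
    by (intro causal_measurable[OF assms(1)]) simp
  show "s t (w(t := z)) = s t w" for w z
    by (intro causal_fun_upd[OF assms(1)]) auto
qed

text \<open>No signal reads a coordinate of maximal rank, so overwriting it affects that one output
  only. This drives both inductions on the rank below.\<close>

lemma shear_insert:
  assumes "causal r (insert t I) s" and "\<And>u. u \<in> I \<Longrightarrow> r u \<le> r t" and "t \<notin> I"
  shows "shear (insert t I) s (w(t := z)) = (shear I s w)(t := s t w + z)"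
proof
  fix u
  show "shear (insert t I) s (w(t := z)) u = ((shear I s w)(t := s t w + z)) u"
  proof (cases "u \<in> insert t I")
    case True
    then have "s u (w(t := z)) = s u w"
      using assms(2)[of u] by (intro causal_fun_upd[OF assms(1)]) auto
    with True show ?thesis using assms(3) by (auto simp: shear_def)
  next
    case False
    then show ?thesis by (simp add: shear_def)
  qed
qed

lemma measurable_shear:
  assumes "causal r I s"
  shows "shear I s \<in> measurable (PiM I (\<lambda>_. borel)) (PiM I (\<lambda>_. borel))"
  unfolding shear_def
  by (intro measurable_restrict borel_measurable_add causal_measurable[OF assms]
      measurable_component_singleton)

text \<open>Back substitution: recover the noise of lower rank first, evaluate the last signal at
  it, and subtract.\<close>

lemma shear_inverse:
  assumes "finite I" and "causal r I s"
  shows "\<exists>S\<in>measurable (PiM I (\<lambda>_. borel)) (PiM I (\<lambda>_. borel)).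
    (\<forall>w\<in>extensional I. S (shear I s w) = w) \<and> (\<forall>y\<in>extensional I. S y \<in> extensional I \<and> shear I s (S y) = y)"
  using assms
proof (induction I rule: finite_ranking_induct[where f=r])
  case empty
  show ?case by (intro bexI[of _ "\<lambda>x. x"]) (auto simp: shear_def)
next
  case (insert t I)
  show ?case
  proof (cases "t \<in> I")
    \<comment> \<open>\<open>finite_ranking_induct\<close> adds elements of maximal rank but does
      not supply \<open>t \<notin> I\<close>; a repeated element leaves the set unchanged.\<close>
    case True
    then have eq: "insert t I = I" by blast
    show ?thesis using insert.prems unfolding eq by (rule insert.IH)
  next
    case False
    note c = causal_remove_last[OF insert.prems insert.hyps(2)]
    note sh = shear_insert[OF insert.prems insert.hyps(2) False]
    obtain S where S[measurable]: "S \<in> measurable (PiM I (\<lambda>_. borel)) (PiM I (\<lambda>_. borel))"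
      and S1: "\<And>w. w \<in> extensional I \<Longrightarrow> S (shear I s w) = w"
      and S2: "\<And>y. y \<in> extensional I \<Longrightarrow> shear I s (S y) = y" 
      and S3: "\<And>y. y \<in> extensional I \<Longrightarrow> S y \<in> extensional I"
      using insert.IH[OF c] by auto
    have [measurable]: "s t \<in> borel_measurable (PiM I (\<lambda>_. borel))"
      by (rule causal_last_measurable[OF insert.prems])
    have upd: "(restrict y I)(t := y t) = y" if "y \<in> extensional (insert t I)" for y :: "'a \<Rightarrow> real"
      using that by (auto simp: fun_eq_iff restrict_def extensional_def)
    define S' where "S' y = (S (restrict y I))(t := y t - s t (S (restrict y I)))" for y
    have [measurable]: "(\<lambda>y. restrict y I) \<in> measurable (PiM (insert t I) (\<lambda>_. borel)) (PiM I (\<lambda>_. borel :: real measure))"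
      by (rule measurable_restrict_subset) auto
    have "S' \<in> measurable (PiM (insert t I) (\<lambda>_. borel)) (PiM (insert t I) (\<lambda>_. borel))"
      unfolding S'_def
      by (rule measurable_fun_upd[where J=I]) auto
    moreover have "S' (shear (insert t I) s w) = w" if "w \<in> extensional (insert t I)" for w
    proof -
      let ?v = "restrict w I"
      have 1: "shear (insert t I) s w = (shear I s ?v)(t := s t ?v + w t)"
        using sh[of ?v "w t"] unfolding upd[OF that] .
      have "restrict (shear (insert t I) s w) I = shear I s ?v"
        unfolding 1 using False by (auto simp: fun_eq_iff shear_def)
      then show ?thesis
        using upd[OF that] by (simp add: S'_def S1 1)
    qed
    moreover have "shear (insert t I) s (S' y) = y" if "y \<in> extensional (insert t I)" for y
      using upd[OF that] by (simp add: S'_def sh S2)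
    moreover have "S' y \<in> extensional (insert t I)" for y
      using S3[of "restrict y I"] by (auto simp: S'_def extensional_def)
    ultimately show ?thesis by blast
  qed
qed

text \<open>Change of variables for a map with unit Jacobian; the product is the density ratio of
  the two product laws along the shear. Fubini integrates a coordinate of maximal rank first. With
  the others fixed, the shear only translates it, and Lebesgue measure is translation
  invariant.\<close>

lemma nn_integral_shear:
  fixes f :: "real \<Rightarrow> real" and g :: "'i \<Rightarrow> real \<Rightarrow> real"
  assumes "finite I" and "causal r I s"
    and F: "F \<in> borel_measurable (PiM I (\<lambda>_. borel))"
    and f[measurable]: "f \<in> borel_measurable borel" and f_pos: "\<And>x. f x > 0"
    and pf: "prob_space (density lborel f)"
    and g[measurable]: "\<And>t. g t \<in> borel_measurable borel" and g_nn: "\<And>t x. g t x \<ge> 0"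
    and pg: "\<And>t. prob_space (density lborel (g t))"
  shows "(\<integral>\<^sup>+w. F (shear I s w) * (\<Prod>t\<in>I. ennreal (g t (s t w + w t) / f (w t))) \<partial>PiM I (\<lambda>_. density lborel f))
    = (\<integral>\<^sup>+y. F y \<partial>PiM I (\<lambda>t. density lborel (g t)))"
  using assms(1-3)
proof (induction I arbitrary: F rule: finite_ranking_induct[where f=r])
  case empty
  show ?case by (simp add: PiM_empty shear_def nn_integral_count_space_finite)
next
  case (insert t I)
  show ?case
  proof (cases "t \<in> I")
    case True
    then have eq: "insert t I = I" by blast
    show ?thesis using insert.prems unfolding eq by (rule insert.IH)
  next
    case False
    interpret A: product_sigma_finite "\<lambda>_. density lborel f"
      using prob_space_imp_sigma_finite[OF pf] by (simp add: product_sigma_finite_def)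
    interpret B: product_sigma_finite "\<lambda>t. density lborel (g t)"
      using prob_space_imp_sigma_finite[OF pg] by (simp add: product_sigma_finite_def)
    note c = causal_remove_last[OF insert.prems(1) insert.hyps(2)]
    note sh = shear_insert[OF insert.prems(1) insert.hyps(2) False]
    have sets1: "sets (PiM J (\<lambda>_. density lborel f)) = sets (PiM J (\<lambda>_. borel))" for J :: "'i set"
      by (rule sets_PiM_cong) auto
    have sets2: "sets (PiM J (\<lambda>t. density lborel (g t))) = sets (PiM J (\<lambda>_. borel))" for J :: "'i set"
      by (rule sets_PiM_cong) auto
    note [measurable] = insert.prems(2) causal_last_measurable[OF insert.prems(1)] measurable_shear[OF c]
      measurable_shear[OF insert.prems(1)]
    have ms[measurable]: "s u \<in> borel_measurable (PiM (insert t I) (\<lambda>_. borel))" if "u \<in> insert t I" for u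
      by (rule causal_measurable[OF insert.prems(1) that])
    have ms'[measurable]: "s u \<in> borel_measurable (PiM I (\<lambda>_. borel))" if "u \<in> I" for u
      by (rule causal_measurable[OF c that])
    \<comment> \<open>The remaining factors do not see coordinate \<open>t\<close>, so they leave
      the inner integral.\<close>
    have prodcong: "(\<Prod>u\<in>I. ennreal (g u (s u (w(t:=z)) + (w(t:=z)) u) / f ((w(t:=z)) u)))
        = (\<Prod>u\<in>I. ennreal (g u (s u w + w u) / f (w u)))" for w z
    proof (rule prod.cong[OF refl])
      fix u assume u: "u \<in> I"
      have "s u (w(t:=z)) = s u w"
        using u insert.hyps(2)[OF u] by (intro causal_fun_upd[OF insert.prems(1)]) auto
      moreover have "u \<noteq> t" using u False by auto
      ultimately show "ennreal (g u (s u (w(t:=z)) + (w(t:=z)) u) / f ((w(t:=z)) u))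
        = ennreal (g u (s u w + w u) / f (w u))" by simp
    qed
    have stz: "s t (w(t:=z)) = s t w" for w z
      by (rule causal_fun_upd[OF insert.prems(1)]) auto
    have upd_m: "(\<lambda>p. (fst p)(t := snd p)) \<in> measurable (PiM I (\<lambda>_. borel) \<Otimes>\<^sub>M borel) (PiM (insert t I) (\<lambda>_. borel :: real measure))"
      by (rule measurable_fun_upd[where J=I]) auto
    have Fm: "(\<lambda>p. F ((fst p)(t := snd p))) \<in> borel_measurable (PiM I (\<lambda>_. borel) \<Otimes>\<^sub>M (borel :: real measure))"
      by (rule measurable_compose[OF upd_m insert.prems(2)])
    have Fm1: "(\<lambda>z. F (x(t := z))) \<in> borel_measurable borel" if "x \<in> space (PiM I (\<lambda>_. borel))" for x
      using measurable_compose[OF measurable_Pair1'[OF that] Fm] by simp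
    define H where "H y = (\<integral>\<^sup>+z. F (y(t := z)) \<partial>density lborel (g t))" for y
    have sets3: "sets (PiM I (\<lambda>_. borel) \<Otimes>\<^sub>M density lborel (g t)) = sets (PiM I (\<lambda>_. borel) \<Otimes>\<^sub>M (borel :: real measure))"
      by (intro sets_pair_measure_cong) auto
    have Hm[measurable]: "H \<in> borel_measurable (PiM I (\<lambda>_. borel))"
      unfolding H_def
      by (rule sigma_finite_measure.borel_measurable_nn_integral[OF prob_space_imp_sigma_finite[OF pg]])
         (use Fm in \<open>simp add: split_beta' measurable_cong_sets[OF sets3 refl]\<close>)
    \<comment> \<open>The inner integral: the density \<open>f\<close> cancels against the ratio,
      and the translation by \<open>s t x\<close> turns what is left into an integral against
      \<open>g t\<close>.\<close>
    have step: "(\<integral>\<^sup>+z. F ((shear I s x)(t := s t x + z)) * ennreal (g t (s t x + z) / f z) \<partial>density lborel f)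
        = H (shear I s x)" if x: "x \<in> space (PiM I (\<lambda>_. borel))" for x
    proof -
      have shx: "shear I s x \<in> space (PiM I (\<lambda>_. borel))"
        using measurable_space[OF measurable_shear[OF c] x] .
      note [measurable] = Fm1[OF shx]
      have "(\<integral>\<^sup>+z. F ((shear I s x)(t := s t x + z)) * ennreal (g t (s t x + z) / f z) \<partial>density lborel f)
        = (\<integral>\<^sup>+z. ennreal (f z) * (F ((shear I s x)(t := s t x + z)) * ennreal (g t (s t x + z) / f z)) \<partial>lborel)"
        by (intro nn_integral_density) (auto intro!: borel_measurable_times_ennreal measurable_compose[OF _ Fm1[OF shx]])
      \<comment> \<open>The factor \<open>1 *\<close> brings the integrand into the shape of
        \<open>nn_integral_real_affine\<close>.\<close>
      also have "\<dots> = (\<integral>\<^sup>+z. F ((shear I s x)(t := s t x + 1 * z)) * ennreal (g t (s t x + 1 * z)) \<partial>lborel)"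
      proof (intro nn_integral_cong)
        fix z
        have "ennreal (f z) * ennreal (g t (s t x + z) / f z) = ennreal (g t (s t x + z))"
          using f_pos[of z] g_nn[of t "s t x + z"] by (simp add: ennreal_mult'[symmetric])
        then show "ennreal (f z) * (F ((shear I s x)(t := s t x + z)) * ennreal (g t (s t x + z) / f z))
          = F ((shear I s x)(t := s t x + 1 * z)) * ennreal (g t (s t x + 1 * z))"
          by (metis mult.left_commute mult_1)
      qed
      also have "\<dots> = (\<integral>\<^sup>+z. F ((shear I s x)(t := z)) * ennreal (g t z) \<partial>lborel)"
        by (subst nn_integral_real_affine[where c=1 and t="s t x"]) auto
      also have "\<dots> = H (shear I s x)"
        unfolding H_def by (subst nn_integral_density) (auto simp: mult.commute)
      finally show ?thesis .
    qed
    have "(\<integral>\<^sup>+w. F (shear (insert t I) s w) * (\<Prod>u\<in>insert t I. ennreal (g u (s u w + w u) / f (w u)))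
          \<partial>PiM (insert t I) (\<lambda>_. density lborel f))
      = (\<integral>\<^sup>+x. (\<integral>\<^sup>+z. F (shear (insert t I) s (x(t:=z))) * (\<Prod>u\<in>insert t I. ennreal (g u (s u (x(t:=z)) + (x(t:=z)) u) / f ((x(t:=z)) u)))
          \<partial>density lborel f) \<partial>PiM I (\<lambda>_. density lborel f))"
    proof (rule A.product_nn_integral_insert[OF insert.hyps(1) False])
      have "(\<lambda>w. \<Prod>u\<in>insert t I. ennreal (g u (s u w + w u) / f (w u))) \<in> borel_measurable (PiM (insert t I) (\<lambda>_. borel))"
        by (intro borel_measurable_prod_ennreal) measurable
      then show "(\<lambda>w. F (shear (insert t I) s w) * (\<Prod>u\<in>insert t I. ennreal (g u (s u w + w u) / f (w u))))
        \<in> borel_measurable (PiM (insert t I) (\<lambda>_. density lborel f))"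
        unfolding measurable_cong_sets[OF sets1 refl]
        by (intro borel_measurable_times_ennreal measurable_compose[OF measurable_shear[OF insert.prems(1)] insert.prems(2)])
    qed
    also have "\<dots> = (\<integral>\<^sup>+x. H (shear I s x) * (\<Prod>u\<in>I. ennreal (g u (s u x + x u) / f (x u))) \<partial>PiM I (\<lambda>_. density lborel f))"
    proof (rule nn_integral_cong)
      fix x assume "x \<in> space (PiM I (\<lambda>_. density lborel f))"
      then have x: "x \<in> space (PiM I (\<lambda>_. borel))" by (simp add: space_PiM)
      have shx: "shear I s x \<in> space (PiM I (\<lambda>_. borel))"
        using measurable_space[OF measurable_shear[OF c] x] .
      have "(\<integral>\<^sup>+z. F (shear (insert t I) s (x(t:=z))) * (\<Prod>u\<in>insert t I. ennreal (g u (s u (x(t:=z)) + (x(t:=z)) u) / f ((x(t:=z)) u)))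
          \<partial>density lborel f)
        = (\<integral>\<^sup>+z. (F ((shear I s x)(t := s t x + z)) * ennreal (g t (s t x + z) / f z)) * (\<Prod>u\<in>I. ennreal (g u (s u x + x u) / f (x u)))
          \<partial>density lborel f)"
        unfolding prod.insert[OF insert.hyps(1) False] prodcong stz
        by (intro nn_integral_cong, subst sh) (simp_all add: mult.assoc)
      also have "\<dots> = (\<integral>\<^sup>+z. (F ((shear I s x)(t := s t x + z)) * ennreal (g t (s t x + z) / f z)) \<partial>density lborel f)
            * (\<Prod>u\<in>I. ennreal (g u (s u x + x u) / f (x u)))"
        by (rule nn_integral_multc) (auto intro!: borel_measurable_times_ennreal measurable_compose[OF _ Fm1[OF shx]])
      finally show "(\<integral>\<^sup>+z. F (shear (insert t I) s (x(t:=z))) * (\<Prod>u\<in>insert t I. ennreal (g u (s u (x(t:=z)) + (x(t:=z)) u) / f ((x(t:=z)) u)))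
          \<partial>density lborel f) = H (shear I s x) * (\<Prod>u\<in>I. ennreal (g u (s u x + x u) / f (x u)))"
        by (simp add: step[OF x])
    qed
    also have "\<dots> = (\<integral>\<^sup>+y. H y \<partial>PiM I (\<lambda>t. density lborel (g t)))"
      by (rule insert.IH[OF c Hm])
    also have "\<dots> = (\<integral>\<^sup>+y. F y \<partial>PiM (insert t I) (\<lambda>t. density lborel (g t)))"
      unfolding H_def
      by (rule B.product_nn_integral_insert[OF insert.hyps(1) False, symmetric])
         (simp add: measurable_cong_sets[OF sets2 refl] insert.prems(2))
    finally show ?thesis .
  qed
qed


section \<open>Change of measure for Gaussian noise\<close>

abbreviation gnoise :: "'i set \<Rightarrow> ('i \<Rightarrow> real) measure" where
  "gnoise I \<equiv> PiM I (\<lambda>_. density lborel std_normal_density)"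

lemma sets_gnoise: "sets (gnoise I) = sets (PiM I (\<lambda>_. borel))"
  by (rule sets_PiM_cong) auto

lemma measurable_gnoise: "measurable (gnoise I) N = measurable (PiM I (\<lambda>_. borel)) N"
  by (rule measurable_cong_sets[OF sets_gnoise refl])

lemma space_gnoise: "space (gnoise I) = extensional I"
  by (simp add: space_PiM PiE_def)

lemma prob_space_gnoise: "prob_space (gnoise I)"
  by (intro prob_space_PiM prob_space_normal_density) simp

text \<open>Log-likelihood ratio of the sheared noise against independent Gaussians of mean 0 and
  standard deviation \<open>\<sigma> t\<close>, as a function of the noise.\<close>
definition llr :: "('i \<Rightarrow> real) \<Rightarrow> 'i set \<Rightarrow> ('i \<Rightarrow> ('i \<Rightarrow> real) \<Rightarrow> real) \<Rightarrow> ('i \<Rightarrow> real) \<Rightarrow> real" where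
  "llr \<sigma> I s w = (\<Sum>t\<in>I. ln (\<sigma> t) - (w t)\<^sup>2 / 2 + (s t w + w t)\<^sup>2 / (2 * (\<sigma> t)\<^sup>2))"

lemma normal_density_ratio:
  assumes "\<sigma> > 0"
  shows "normal_density 0 \<sigma> y / std_normal_density z = exp (- (ln \<sigma> - z\<^sup>2 / 2 + y\<^sup>2 / (2 * \<sigma>\<^sup>2)))"
proof -
  have "- (ln \<sigma> - z\<^sup>2 / 2 + y\<^sup>2 / (2 * \<sigma>\<^sup>2)) = - y\<^sup>2 / (2 * \<sigma>\<^sup>2) - (ln \<sigma> + - z\<^sup>2 / 2)"
    by simp
  then have "exp (- (ln \<sigma> - z\<^sup>2 / 2 + y\<^sup>2 / (2 * \<sigma>\<^sup>2))) = exp (- y\<^sup>2 / (2 * \<sigma>\<^sup>2)) / (\<sigma> * exp (- z\<^sup>2 / 2))"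
    using assms by (simp only: exp_diff exp_add exp_ln)
  then show ?thesis
    using assms by (simp add: normal_density_def real_sqrt_mult field_simps)
qed

lemma prod_normal_density_ratio:
  assumes "\<And>t. \<sigma> t > 0"
  shows "(\<Prod>t\<in>I. ennreal (normal_density 0 (\<sigma> t) (s t w + w t) / std_normal_density (w t)))
    = ennreal (exp (- llr \<sigma> I s w))"
proof (cases "finite I")
  case True
  then show ?thesis
    by (simp add: normal_density_ratio[OF assms] prod_ennreal exp_sum[symmetric] llr_def sum_negf[symmetric])
qed (simp add: llr_def)

text \<open>By the change of variables, each summand is the probability, under one reference law
  common to all messages, of the image of \<open>G m\<close> under its shear. The hypothesis
  \<open>disj\<close> makes these images disjoint.\<close>

lemma sum_likelihood_disjoint_le_1:
  assumes I: "finite I" and M: "finite M" and c: "\<And>m. m \<in> M \<Longrightarrow> causal r I (s m)"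
    and G: "\<And>m. m \<in> M \<Longrightarrow> G m \<in> sets (gnoise I)" and \<sigma>: "\<And>t. \<sigma> t > 0"
    and disj: "\<And>m m' w w'. m \<in> M \<Longrightarrow> m' \<in> M \<Longrightarrow> w \<in> G m \<Longrightarrow> w' \<in> G m' \<Longrightarrow>
      shear I (s m) w = shear I (s m') w' \<Longrightarrow> m = m'"
  shows "(\<Sum>m\<in>M. \<integral>\<^sup>+w. indicator (G m) w * ennreal (exp (- llr \<sigma> I (s m) w)) \<partial>gnoise I) \<le> 1"
proof -
  define Q where "Q = PiM I (\<lambda>t. density lborel (normal_density 0 (\<sigma> t)))"
  interpret Q: prob_space Q
    unfolding Q_def by (intro prob_space_PiM prob_space_normal_density \<sigma>)
  have setsQ: "sets Q = sets (PiM I (\<lambda>_. borel))"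
    unfolding Q_def by (rule sets_PiM_cong) auto
  have spaceQ: "space Q = extensional I"
    by (simp add: Q_def space_PiM PiE_def)
  have "\<forall>m\<in>M. \<exists>S. S \<in> measurable (PiM I (\<lambda>_. borel)) (PiM I (\<lambda>_. borel)) \<and>
    (\<forall>w\<in>extensional I. S (shear I (s m) w) = w) \<and>
    (\<forall>y\<in>extensional I. S y \<in> extensional I \<and> shear I (s m) (S y) = y)"
    using shear_inverse[OF I c] by blast
  then obtain S where S: "\<And>m. m \<in> M \<Longrightarrow> S m \<in> measurable (PiM I (\<lambda>_. borel)) (PiM I (\<lambda>_. borel))"
    and S1: "\<And>m w. m \<in> M \<Longrightarrow> w \<in> extensional I \<Longrightarrow> S m (shear I (s m) w) = w"
    and S2: "\<And>m y. m \<in> M \<Longrightarrow> y \<in> extensional I \<Longrightarrow> shear I (s m) (S m y) = y"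
    by metis
  \<comment> \<open>On the product space this is the indicator of the image of \<open>G m\<close>.
    Writing it through the measurable inverse settles its measurability.\<close>
  define F :: "'b \<Rightarrow> ('a \<Rightarrow> real) \<Rightarrow> ennreal" where "F m y = indicator (G m) (S m y)" for m y
  have Fm: "F m \<in> borel_measurable (PiM I (\<lambda>_. borel))" if "m \<in> M" for m
    unfolding F_def using G[OF that]
    by (intro measurable_compose[OF S[OF that]] borel_measurable_indicator) (simp add: sets_gnoise)
  have eq: "(\<integral>\<^sup>+w. indicator (G m) w * ennreal (exp (- llr \<sigma> I (s m) w)) \<partial>gnoise I) = (\<integral>\<^sup>+y. F m y \<partial>Q)"
    if m: "m \<in> M" for m
  proof -
    have "(\<integral>\<^sup>+w. indicator (G m) w * ennreal (exp (- llr \<sigma> I (s m) w)) \<partial>gnoise I)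
      = (\<integral>\<^sup>+w. F m (shear I (s m) w) * (\<Prod>t\<in>I. ennreal (normal_density 0 (\<sigma> t) (s m t w + w t) / std_normal_density (w t))) \<partial>gnoise I)"
      unfolding prod_normal_density_ratio[OF \<sigma>, where s="s m"]
      by (intro nn_integral_cong) (simp add: F_def S1[OF m] space_gnoise)
    also have "\<dots> = (\<integral>\<^sup>+y. F m y \<partial>Q)"
      unfolding Q_def
      by (rule nn_integral_shear[OF I c[OF m] Fm[OF m]])
         (auto intro!: prob_space_normal_density normal_density_pos \<sigma>)
    finally show ?thesis .
  qed
  have le1: "(\<Sum>m\<in>M. F m y) \<le> 1" if y: "y \<in> space Q" for y
  proof (cases "\<exists>m\<in>M. S m y \<in> G m")
    case True
    then obtain m where m: "m \<in> M" "S m y \<in> G m" by blast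
    have "F m' y = 0" if "m' \<in> M - {m}" for m'
      using disj[of m m' "S m y" "S m' y"] m that y by (auto simp: F_def indicator_def S2 spaceQ)
    then have "(\<Sum>m'\<in>M. F m' y) = F m y"
      using m M by (subst sum.remove[of _ m]) auto
    then show ?thesis by (simp add: F_def indicator_def)
  next
    case False
    then show ?thesis by (simp add: F_def)
  qed
  have "(\<Sum>m\<in>M. \<integral>\<^sup>+w. indicator (G m) w * ennreal (exp (- llr \<sigma> I (s m) w)) \<partial>gnoise I)
    = (\<integral>\<^sup>+y. (\<Sum>m\<in>M. F m y) \<partial>Q)"
    using Fm by (subst nn_integral_sum) (auto simp: eq measurable_cong_sets[OF setsQ refl])
  also have "\<dots> \<le> (\<integral>\<^sup>+y. 1 \<partial>Q)"
    by (intro nn_integral_mono le1)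
  also have "\<dots> = 1"
    by (simp add: Q.emeasure_space_1)
  finally show ?thesis .
qed

section \<open>Second moments of causal signals in Gaussian noise\<close>

lemma gnoise_component_moments:
  assumes "t \<in> I"
  shows "integrable (gnoise I) (\<lambda>w. (w t)\<^sup>2)" "(\<integral>w. (w t)\<^sup>2 \<partial>gnoise I) = 1"
proof -
  let ?D = "density lborel std_normal_density"
  have d: "distr (gnoise I) ?D (\<lambda>w. w t) = ?D"
    using assms by (intro distr_PiM_component prob_space_normal_density) auto
  have m: "(\<lambda>w. w t) \<in> measurable (gnoise I) ?D"
    using assms by simp
  have "integrable ?D (\<lambda>x. x\<^sup>2)"
    using integrable_std_normal_moment[of 2] by (subst integrable_density) auto
  then show "integrable (gnoise I) (\<lambda>w. (w t)\<^sup>2)"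
    using integrable_distr[OF m, of "\<lambda>x. x\<^sup>2"] by (simp add: d)
  have "(\<integral>x. x\<^sup>2 \<partial>?D) = 1"
    using integral_std_normal_moment_even[of 1] by (subst integral_density) auto
  then show "(\<integral>w. (w t)\<^sup>2 \<partial>gnoise I) = 1"
    using integral_distr[OF m, of "\<lambda>x. x\<^sup>2"] by (simp add: d)
qed

lemma integrable_mult_squares:
  fixes f g :: "'a \<Rightarrow> real"
  assumes "f \<in> borel_measurable M" "g \<in> borel_measurable M"
    and "integrable M (\<lambda>x. (f x)\<^sup>2)" "integrable M (\<lambda>x. (g x)\<^sup>2)"
  shows "integrable M (\<lambda>x. f x * g x)"
proof (rule Bochner_Integration.integrable_bound)
  show "integrable M (\<lambda>x. (f x)\<^sup>2 + (g x)\<^sup>2)"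
    using assms by simp
  show "(\<lambda>x. f x * g x) \<in> borel_measurable M" using assms by simp
  have "\<bar>a * b\<bar> \<le> a\<^sup>2 + b\<^sup>2" for a b :: real
  proof -
    have "2 * (\<bar>a\<bar> * \<bar>b\<bar>) \<le> a\<^sup>2 + b\<^sup>2"
      using sum_squares_bound[of "\<bar>a\<bar>" "\<bar>b\<bar>"] by (simp add: mult.assoc)
    moreover have "0 \<le> \<bar>a\<bar> * \<bar>b\<bar>" by simp
    ultimately show ?thesis unfolding abs_mult by linarith
  qed
  then show "AE x in M. norm (f x * g x) \<le> norm ((f x)\<^sup>2 + (g x)\<^sup>2)" by simp
qed

text \<open>Integrating coordinate \<open>t\<close> first leaves a multiple of its mean, which is
  0.\<close>

lemma gnoise_uncorrelated:
  assumes I: "finite I" "t \<in> I" and X: "X \<in> borel_measurable (gnoise I)" "integrable (gnoise I) (\<lambda>w. (X w)\<^sup>2)"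
    and indep: "\<And>w z. X (w(t := z)) = X w"
  shows "integrable (gnoise I) (\<lambda>w. X w * w t)" "(\<integral>w. X w * w t \<partial>gnoise I) = 0"
proof -
  show int: "integrable (gnoise I) (\<lambda>w. X w * w t)"
    using assms by (intro integrable_mult_squares gnoise_component_moments) (auto simp: measurable_gnoise)
  interpret product_sigma_finite "\<lambda>_. density lborel std_normal_density"
    using prob_space_imp_sigma_finite[OF prob_space_normal_density]
    by (simp add: product_sigma_finite_def)
  define J where "J = I - {t}"
  have J: "I = insert t J" "t \<notin> J" "finite J" using I by (auto simp: J_def)
  have z: "(\<integral>y. y \<partial>density lborel std_normal_density) = 0"
    using integral_std_normal_moment_odd[of 0] by (subst integral_density) auto
  have "(\<integral>w. X w * w t \<partial>gnoise I) = (\<integral>w. (\<integral>y. X (w(t := y)) * (w(t := y)) t \<partial>density lborel std_normal_density) \<partial>gnoise J)"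
    using product_integral_insert[OF J(3,2), of "\<lambda>w. X w * w t"] int unfolding J(1) by simp
  also have "\<dots> = 0"
    by (simp add: indep z)
  finally show "(\<integral>w. X w * w t \<partial>gnoise I) = 0" .
qed

text \<open>The signal reads only noise of strictly lower rank, so the cross term vanishes and the
  variances add.\<close>

lemma causal_square_moment:
  assumes I: "finite I" "t \<in> I" and c: "causal r I s" and s2: "integrable (gnoise I) (\<lambda>w. (s t w)\<^sup>2)"
  shows "integrable (gnoise I) (\<lambda>w. (s t w + w t)\<^sup>2)"
    "(\<integral>w. (s t w + w t)\<^sup>2 \<partial>gnoise I) = (\<integral>w. (s t w)\<^sup>2 \<partial>gnoise I) + 1"
proof -
  have m: "s t \<in> borel_measurable (gnoise I)"
    by (simp add: measurable_gnoise causal_measurable[OF c I(2)])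
  have st: "s t (w(t := z)) = s t w" for w z
    by (rule causal_fun_upd[OF c I(2)]) simp
  note u = gnoise_uncorrelated[OF I m s2 st]
  have e: "(s t w + w t)\<^sup>2 = (s t w)\<^sup>2 + 2 * (s t w * w t) + (w t)\<^sup>2" for w
    by (simp add: power2_sum)
  show "integrable (gnoise I) (\<lambda>w. (s t w + w t)\<^sup>2)"
    unfolding e using s2 u gnoise_component_moments[OF I(2)] by simp
  show "(\<integral>w. (s t w + w t)\<^sup>2 \<partial>gnoise I) = (\<integral>w. (s t w)\<^sup>2 \<partial>gnoise I) + 1"
    unfolding e using s2 u gnoise_component_moments[OF I(2)] by simp
qed

text \<open>The code enters the expectation only through the second moments of the signals, which is
  all that a power constraint controls.\<close>

lemma llr_expectation:
  assumes I: "finite I" and c: "causal r I s" and s2: "\<And>t. t \<in> I \<Longrightarrow> integrable (gnoise I) (\<lambda>w. (s t w)\<^sup>2)"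
  shows "integrable (gnoise I) (llr \<sigma> I s)"
    "(\<integral>w. llr \<sigma> I s w \<partial>gnoise I)
      = (\<Sum>t\<in>I. ln (\<sigma> t) - 1 / 2 + ((\<integral>w. (s t w)\<^sup>2 \<partial>gnoise I) + 1) / (2 * (\<sigma> t)\<^sup>2))"
proof -
  interpret prob_space "gnoise I" by (rule prob_space_gnoise)
  note m = causal_square_moment[OF I _ c s2] gnoise_component_moments
  show "integrable (gnoise I) (llr \<sigma> I s)"
    unfolding llr_def[abs_def] by (intro Bochner_Integration.integrable_sum Bochner_Integration.integrable_add
      Bochner_Integration.integrable_diff integrable_divide m integrable_const) 
  show "(\<integral>w. llr \<sigma> I s w \<partial>gnoise I)
      = (\<Sum>t\<in>I. ln (\<sigma> t) - 1 / 2 + ((\<integral>w. (s t w)\<^sup>2 \<partial>gnoise I) + 1) / (2 * (\<sigma> t)\<^sup>2))"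
    unfolding llr_def
    by (subst Bochner_Integration.integral_sum) (auto simp: m prob_space intro!: sum.cong)
qed

section \<open>The converse by change of measure and Jensen's inequality\<close>

text \<open>\<open>K\<close> stands for the number of messages to be resolved and \<open>p\<close>
  for the average success probability. Jensen's inequality bounds the left side of
  \<open>good\<close> below by \<open>card M * p * exp (- t)\<close>, with \<open>t\<close> the
  conditional mean of \<open>L\<close> given success. The \<open>+ 1\<close> pays for replacing the
  mean of \<open>L\<close> on the success event by its full mean.\<close>

lemma change_of_measure_bound:
  fixes L :: "'m \<Rightarrow> 'w \<Rightarrow> real" and B K p :: real
  assumes N: "prob_space N" and M: "finite M" "M \<noteq> {}"
    and G: "\<And>m. m \<in> M \<Longrightarrow> G m \<in> sets N" and L: "\<And>m. m \<in> M \<Longrightarrow> integrable N (L m)"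
    and total: "\<And>m. m \<in> M \<Longrightarrow> (\<integral>\<^sup>+w. ennreal (exp (- L m w)) \<partial>N) \<le> 1"
    and K: "K > 0"
    and good: "(\<Sum>m\<in>M. \<integral>\<^sup>+w. indicator (G m) w * ennreal (exp (- L m w)) \<partial>N) \<le> ennreal (card M / K)"
    and mean: "(\<Sum>m\<in>M. \<integral>w. L m w \<partial>N) \<le> card M * B"
    and p: "(\<Sum>m\<in>M. measure N (G m)) = card M * p" "p > 0"
  shows "ln K \<le> (B + 1) / p - ln p"
proof -
  interpret prob_space N by fact
  have cM: "real (card M) > 0" using M by (simp add: card_gt_0_iff)
  have Lm: "L m \<in> borel_measurable N" if "m \<in> M" for m
    using L[OF that] by simp
  have iE: "integrable N (\<lambda>w. exp (- L m w))" if "m \<in> M" for m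
    using total[OF that] Lm[OF that] by (intro integrableI_nonneg) (auto simp: order.strict_trans1)
  have E1: "(\<integral>w. exp (- L m w) \<partial>N) \<le> 1" if "m \<in> M" for m
    using total[OF that] nn_integral_eq_integral[OF iE[OF that]] by simp
  have iGE: "integrable N (\<lambda>w. indicator (G m) w * exp (- L m w))" if "m \<in> M" for m
    using integrable_real_mult_indicator[OF G[OF that] iE[OF that]] by (simp add: mult.commute)
  have iGL: "integrable N (\<lambda>w. indicator (G m) w * L m w)" if "m \<in> M" for m
    using integrable_real_mult_indicator[OF G[OF that] L[OF that]] by (simp add: mult.commute)
  have iG: "integrable N (\<lambda>w. indicator (G m) w :: real)" if "m \<in> M" for m
    using G[OF that] by (simp add: emeasure_eq_measure)
  \<comment> \<open>On failure \<open>L\<close> may be negative, but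
    \<open>L \<ge> - exp (- L)\<close> and \<open>exp (- L)\<close> integrates to at most 1.\<close>
  have GL: "(\<integral>w. indicator (G m) w * L m w \<partial>N) \<le> (\<integral>w. L m w \<partial>N) + 1" if m: "m \<in> M" for m
  proof -
    have "(\<integral>w. indicator (G m) w * L m w \<partial>N) \<le> (\<integral>w. L m w + exp (- L m w) \<partial>N)"
    proof (rule integral_mono)
      fix w
      have "- L m w \<le> exp (- L m w)" using exp_ge_add_one_self[of "- L m w"] by linarith
      then show "indicator (G m) w * L m w \<le> L m w + exp (- L m w)"
        by (cases "w \<in> G m") auto
    qed (use iGL[OF m] L[OF m] iE[OF m] in auto)
    also have "\<dots> \<le> (\<integral>w. L m w \<partial>N) + 1"
      using L[OF m] iE[OF m] E1[OF m] by simp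
    finally show ?thesis .
  qed
  \<comment> \<open>Jensen's inequality for exp, via the tangent at the conditional mean of L given success\<close>
  define t where "t = (\<Sum>m\<in>M. \<integral>w. indicator (G m) w * L m w \<partial>N) / (card M * p)"
  have "(\<Sum>m\<in>M. \<integral>w. indicator (G m) w * L m w \<partial>N) \<le> (\<Sum>m\<in>M. (\<integral>w. L m w \<partial>N) + 1)"
    by (intro sum_mono GL)
  also have "\<dots> \<le> card M * (B + 1)"
    using mean by (simp add: sum.distrib algebra_simps)
  finally have t_le: "t \<le> (B + 1) / p"
    unfolding t_def using cM p(2) by (simp add: field_simps)
  have "exp (- t) * ((1 + t) * measure N (G m) - (\<integral>w. indicator (G m) w * L m w \<partial>N))
      \<le> (\<integral>w. indicator (G m) w * exp (- L m w) \<partial>N)" if m: "m \<in> M" for m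
  proof -
    have "exp (- t) * ((1 + t) * measure N (G m) - (\<integral>w. indicator (G m) w * L m w \<partial>N))
      = (\<integral>w. exp (- t) * ((1 + t) * indicator (G m) w - indicator (G m) w * L m w) \<partial>N)"
      using iG[OF m] iGL[OF m] G[OF m] by simp
    also have "\<dots> \<le> (\<integral>w. indicator (G m) w * exp (- L m w) \<partial>N)"
    proof (rule integral_mono)
      fix w
      have "exp (- t) * (1 + (t - L m w)) \<le> exp (- t) * exp (t - L m w)"
        by (intro mult_left_mono exp_ge_add_one_self) auto
      also have "\<dots> = exp (- L m w)" by (simp flip: exp_add)
      finally show "exp (- t) * ((1 + t) * indicator (G m) w - indicator (G m) w * L m w)
        \<le> indicator (G m) w * exp (- L m w)"
        by (cases "w \<in> G m") (auto simp: algebra_simps)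
    qed (use iG[OF m] iGL[OF m] iGE[OF m] in auto)
    finally show ?thesis .
  qed
  then have "(\<Sum>m\<in>M. exp (- t) * ((1 + t) * measure N (G m) - (\<integral>w. indicator (G m) w * L m w \<partial>N)))
      \<le> (\<Sum>m\<in>M. \<integral>w. indicator (G m) w * exp (- L m w) \<partial>N)"
    by (intro sum_mono)
  moreover have "(\<Sum>m\<in>M. exp (- t) * ((1 + t) * measure N (G m) - (\<integral>w. indicator (G m) w * L m w \<partial>N)))
      = exp (- t) * (card M * p)"
  proof -
    have "(\<Sum>m\<in>M. \<integral>w. indicator (G m) w * L m w \<partial>N) = t * (card M * p)"
      unfolding t_def using cM p(2) by simp
    then show ?thesis
      unfolding sum_distrib_left[symmetric] sum_subtractf p(1) by (simp add: algebra_simps)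
  qed
  moreover have "(\<Sum>m\<in>M. \<integral>w. indicator (G m) w * exp (- L m w) \<partial>N) \<le> card M / K"
  proof -
    have "ennreal (\<Sum>m\<in>M. \<integral>w. indicator (G m) w * exp (- L m w) \<partial>N)
      = (\<Sum>m\<in>M. ennreal (\<integral>w. indicator (G m) w * exp (- L m w) \<partial>N))"
      by (intro sum_ennreal[symmetric] Bochner_Integration.integral_nonneg) simp
    also have "\<dots> = (\<Sum>m\<in>M. \<integral>\<^sup>+w. indicator (G m) w * ennreal (exp (- L m w)) \<partial>N)"
    proof (rule sum.cong[OF refl])
      fix m assume m: "m \<in> M"
      have "(\<integral>\<^sup>+w. indicator (G m) w * ennreal (exp (- L m w)) \<partial>N)
        = (\<integral>\<^sup>+w. ennreal (indicator (G m) w * exp (- L m w)) \<partial>N)"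
        by (intro nn_integral_cong) (auto simp: indicator_def)
      then show "ennreal (\<integral>w. indicator (G m) w * exp (- L m w) \<partial>N)
        = (\<integral>\<^sup>+w. indicator (G m) w * ennreal (exp (- L m w)) \<partial>N)"
        using nn_integral_eq_integral[OF iGE[OF m]] by simp
    qed
    finally have "ennreal (\<Sum>m\<in>M. \<integral>w. indicator (G m) w * exp (- L m w) \<partial>N) \<le> ennreal (card M / K)"
      using good by (rule ord_eq_le_trans)
    then show ?thesis using K by (subst (asm) ennreal_le_iff) auto
  qed
  ultimately have "exp (- t) * (card M * p) \<le> card M / K" by linarith
  then have "K * p \<le> exp t"
    using cM K by (simp add: exp_minus field_simps)
  then have "ln (K * p) \<le> t"
    using K p(2) by (metis ln_exp ln_le_cancel_iff exp_gt_zero mult_pos_pos)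
  then show ?thesis using t_le K p(2) by (simp add: ln_mult)
qed

text \<open>\<open>v\<close> is side information given to the decoder. Messages sharing a value of
  \<open>v\<close> have likelihoods summing to at most 1, so the total is at most the number of
  values of \<open>v\<close>, hence at most \<open>card M / K\<close>.\<close>

lemma shear_converse:
  fixes B K p :: real
  assumes I: "finite I" and M: "finite M" "M \<noteq> {}" and c: "\<And>m. m \<in> M \<Longrightarrow> causal r I (s m)"
    and s2: "\<And>m t. m \<in> M \<Longrightarrow> t \<in> I \<Longrightarrow> integrable (gnoise I) (\<lambda>w. (s m t w)\<^sup>2)"
    and G: "\<And>m. m \<in> M \<Longrightarrow> G m \<in> sets (gnoise I)" and \<sigma>: "\<And>t. \<sigma> t > 0"
    and decodable: "\<And>m m' w w'. m \<in> M \<Longrightarrow> m' \<in> M \<Longrightarrow> v m = v m' \<Longrightarrow> w \<in> G m \<Longrightarrow> w' \<in> G m' \<Longrightarrow>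
      shear I (s m) w = shear I (s m') w' \<Longrightarrow> m = m'"
    and K: "K > 0" "card (v ` M) * K \<le> card M"
    and mean: "(\<Sum>m\<in>M. \<Sum>t\<in>I. ln (\<sigma> t) - 1 / 2 + ((\<integral>w. (s m t w)\<^sup>2 \<partial>gnoise I) + 1) / (2 * (\<sigma> t)\<^sup>2))
      \<le> card M * B"
    and p: "(\<Sum>m\<in>M. measure (gnoise I) (G m)) = card M * p" "p > 0"
  shows "ln K \<le> (B + 1) / p - ln p"
proof (rule change_of_measure_bound[OF prob_space_gnoise M G _ _ K(1) _ _ p, where L="\<lambda>m. llr \<sigma> I (s m)"])
  show "integrable (gnoise I) (llr \<sigma> I (s m))" if "m \<in> M" for m
    by (rule llr_expectation[OF I c[OF that] s2[OF that]])
  show "(\<integral>\<^sup>+w. ennreal (exp (- llr \<sigma> I (s m) w)) \<partial>gnoise I) \<le> 1" if m: "m \<in> M" for m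
  proof -
    \<comment> \<open>A single message with the whole space as its success region satisfies the
      disjointness condition trivially.\<close>
    have "(\<integral>\<^sup>+w. ennreal (exp (- llr \<sigma> I (s m) w)) \<partial>gnoise I)
      = (\<Sum>m\<in>{m}. \<integral>\<^sup>+w. indicator (space (gnoise I)) w * ennreal (exp (- llr \<sigma> I (s m) w)) \<partial>gnoise I)"
      by (auto intro!: nn_integral_cong)
    also have "\<dots> \<le> 1"
      using c[OF m] by (intro sum_likelihood_disjoint_le_1[OF I _ _ _ \<sigma>, where r=r]) auto
    finally show ?thesis .
  qed
  have "(\<Sum>m\<in>M. \<integral>\<^sup>+w. indicator (G m) w * ennreal (exp (- llr \<sigma> I (s m) w)) \<partial>gnoise I)
    = (\<Sum>u\<in>v ` M. \<Sum>m\<in>{m \<in> M. v m = u}. \<integral>\<^sup>+w. indicator (G m) w * ennreal (exp (- llr \<sigma> I (s m) w)) \<partial>gnoise I)"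
    by (rule sum.image_gen[OF M(1)])
  also have "\<dots> \<le> (\<Sum>u\<in>v ` M. 1)"
  proof (rule sum_mono)
    fix u
    show "(\<Sum>m\<in>{m \<in> M. v m = u}. \<integral>\<^sup>+w. indicator (G m) w * ennreal (exp (- llr \<sigma> I (s m) w)) \<partial>gnoise I) \<le> 1"
      using M(1) by (intro sum_likelihood_disjoint_le_1[OF I _ _ _ \<sigma>, where r=r]) (auto intro: c G decodable)
  qed
  also have "\<dots> = ennreal (card (v ` M))"
    by (simp add: ennreal_of_nat_eq_real_of_nat)
  also have "\<dots> \<le> ennreal (card M / K)"
    using K by (intro ennreal_leI) (simp add: field_simps)
  finally show "(\<Sum>m\<in>M. \<integral>\<^sup>+w. indicator (G m) w * ennreal (exp (- llr \<sigma> I (s m) w)) \<partial>gnoise I)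
    \<le> ennreal (card M / K)" .
  show "(\<Sum>m\<in>M. \<integral>w. llr \<sigma> I (s m) w \<partial>gnoise I) \<le> card M * B"
    using mean by (simp add: llr_expectation(2)[OF I c s2])
qed

section \<open>Cut bounds for the Y-channel\<close>

lemma hist_cong:
  assumes "\<And>a i'. a \<in> {0..3} \<Longrightarrow> i' < i \<Longrightarrow> w (a, i') = w' (a, i')"
  shows "hist h1 h2 h3 c m w i = hist h1 h2 h3 c m w' i"
  using assms
proof (induction i)
  case (Suc i)
  have "hist h1 h2 h3 c m w i = hist h1 h2 h3 c m w' i"
    by (rule Suc.IH) (auto intro: Suc.prems)
  moreover have "w (a, i) = w' (a, i)" if "a = 0 \<or> a \<in> users" for a
    using that by (intro Suc.prems) (auto simp: users_def)
  ultimately show ?case by (simp add: Let_def fun_eq_iff)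
qed simp

lemma inp_cong:
  assumes "\<And>a i'. a \<in> {0..3} \<Longrightarrow> i' < i \<Longrightarrow> w (a, i') = w' (a, i')"
  shows "inp h1 h2 h3 c m w a i = inp h1 h2 h3 c m w' a i"
  unfolding inp_def using hist_cong[of i w w', OF assms] by simp

section \<open>Counting message tuples\<close>

text \<open>Members of \<open>msgs\<close> take the default value 1 off \<open>pairs\<close>,
  whereas \<open>PiE\<close> uses \<open>undefined\<close>. Translating between the two conventions
  yields finiteness and cardinality.\<close>

lemma bij_betw_msgs:
  "bij_betw (\<lambda>m. \<lambda>(j, k)\<in>pairs. m j k) (msgs n R) (PiE pairs (\<lambda>(j, k). {1..nmsg n (R j k)}))"
proof (rule bij_betw_byWitness[where f'="\<lambda>f j k. if (j, k) \<in> pairs then f (j, k) else 1"])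
  show "\<forall>m\<in>msgs n R. (\<lambda>j k. if (j, k) \<in> pairs then (\<lambda>(j, k)\<in>pairs. m j k) (j, k) else 1) = m"
  proof (intro ballI ext)
    fix m j k assume "m \<in> msgs n R"
    then have "if (j, k) \<in> pairs then m j k \<in> {1..nmsg n (R j k)} else m j k = 1"
      unfolding msgs_def by blast
    then show "(if (j, k) \<in> pairs then (\<lambda>(j, k)\<in>pairs. m j k) (j, k) else 1) = m j k"
      by (auto split: if_splits)
  qed
  show "\<forall>f\<in>PiE pairs (\<lambda>(j, k). {1..nmsg n (R j k)}).
    (\<lambda>(j, k)\<in>pairs. (\<lambda>j k. if (j, k) \<in> pairs then f (j, k) else 1) j k) = f"
    by (auto simp: fun_eq_iff PiE_def extensional_def restrict_def)
  show "(\<lambda>m. \<lambda>(j, k)\<in>pairs. m j k) ` msgs n R \<subseteq> PiE pairs (\<lambda>(j, k). {1..nmsg n (R j k)})"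
  proof
    fix f assume "f \<in> (\<lambda>m. \<lambda>(j, k)\<in>pairs. m j k) ` msgs n R"
    then obtain m where m: "m \<in> msgs n R" "f = (\<lambda>(j, k)\<in>pairs. m j k)" by blast
    then have "m j k \<in> {1..nmsg n (R j k)}" if "(j, k) \<in> pairs" for j k
      using that unfolding msgs_def mem_Collect_eq by metis
    then show "f \<in> PiE pairs (\<lambda>(j, k). {1..nmsg n (R j k)})"
      unfolding m(2) by (intro restrict_PiE_iff[THEN iffD2]) auto
  qed
  show "(\<lambda>f j k. if (j, k) \<in> pairs then f (j, k) else 1) ` PiE pairs (\<lambda>(j, k). {1..nmsg n (R j k)}) \<subseteq> msgs n R"
    unfolding msgs_def by (auto dest: PiE_mem)
qed

lemma finite_pairs: "finite pairs"
  by (rule finite_subset[of _ "users \<times> users"]) (auto simp: pairs_def users_def)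

lemma finite_msgs: "finite (msgs n R)"
  using bij_betw_finite[OF bij_betw_msgs] finite_pairs by (auto intro!: finite_PiE)

lemma card_msgs: "card (msgs n R) = (\<Prod>(j, k)\<in>pairs. nmsg n (R j k))"
  using bij_betw_same_card[OF bij_betw_msgs] finite_pairs
  by (simp add: card_PiE split_beta')

lemma nmsg_ge: "real (nmsg n r) \<ge> 2 powr (real n * r)"
  unfolding nmsg_def by (simp add: of_nat_ceiling)

lemma nmsg_pos: "nmsg n r > 0"
proof -
  have "0 < (2::real) powr (real n * r)" by simp
  then show ?thesis using nmsg_ge[of n r] by linarith
qed

lemma msgs_nonempty: "msgs n R \<noteq> {}"
proof -
  have "card (msgs n R) > 0" unfolding card_msgs
    by (rule prod_pos) (auto simp: nmsg_pos)
  then show ?thesis by auto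
qed


text \<open>The two cuts share this argument and differ in the triangular system \<open>s\<close>
  and the reference deviations \<open>\<sigma>\<close>. The \<open>\<kappa>\<close> act as Lagrange
  multipliers: one channel use may exceed \<open>B\<close> by a weighted power excess, because that
  excess is nonpositive after averaging over messages and time. \<open>recover\<close> may assume
  equal messages of user \<open>j\<close> since they belong to the side information.\<close>

lemma code_converse:
  fixes P B :: real and \<kappa> :: "nat \<Rightarrow> real"
  defines "I n \<equiv> {0..3::nat} \<times> {..<n::nat}"
  assumes valid: "valid_code h1 h2 h3 P n R c" and n: "n > 0"
    and jkl: "j \<in> users" "k \<in> users" "l \<in> users" "j \<noteq> k" "j \<noteq> l" "k \<noteq> l"
    and causal: "\<And>m. m \<in> msgs n R \<Longrightarrow> causal r (I n) (s m)"
    and s2: "\<And>m t. m \<in> msgs n R \<Longrightarrow> t \<in> I n \<Longrightarrow> integrable (gnoise (I n)) (\<lambda>w. (s m t w)\<^sup>2)"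
    and \<sigma>: "\<And>t. \<sigma> t > 0" and \<kappa>: "\<And>a. \<kappa> a \<ge> 0"
    and energy: "\<And>m i. m \<in> msgs n R \<Longrightarrow> i < n \<Longrightarrow>
      (\<Sum>a\<in>{0..3}. ln (\<sigma> (a, i)) - 1 / 2 + ((\<integral>w. (s m (a, i) w)\<^sup>2 \<partial>gnoise (I n)) + 1) / (2 * (\<sigma> (a, i))\<^sup>2))
      \<le> B + (\<Sum>a\<in>{0..3}. \<kappa> a * ((\<integral>w. (inp h1 h2 h3 c m w a i)\<^sup>2 \<partial>gnoise (I n)) - P))"
    and recover: "\<And>m m' w w'. m j = m' j \<Longrightarrow> shear (I n) (s m) w = shear (I n) (s m') w' \<Longrightarrow>
      hist h1 h2 h3 c m w n j = hist h1 h2 h3 c m' w' n j \<and> hist h1 h2 h3 c m w n l = hist h1 h2 h3 c m' w' n l"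
    and perr: "perr h1 h2 h3 n R c < 1"
  shows "real n * (R k j + R l j + R k l) * ln 2
    \<le> (real n * B + 1) / (1 - perr h1 h2 h3 n R c) - ln (1 - perr h1 h2 h3 n R c)"
proof -
  let ?M = "msgs n R"
  have noise: "noise n = gnoise (I n)" by (simp add: noise_def I_def)
  interpret prob_space "noise n" unfolding noise by (rule prob_space_gnoise)
  have cM: "real (card ?M) > 0" using finite_msgs[of n R] msgs_nonempty[of n R] by (simp add: card_gt_0_iff)
  define G where "G m = space (noise n) - err_event h1 h2 h3 n c m" for m
  define K where "K = real (nmsg n (R k j) * nmsg n (R l j) * nmsg n (R k l))"
  have err: "err_event h1 h2 h3 n c m \<in> sets (noise n)" if "m \<in> ?M" for m
    using valid that by (simp add: valid_code_def)
  have pairs: "pairs = {(j, k), (j, l), (l, k), (k, j), (l, j), (k, l)}"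
    using jkl by (auto simp: pairs_def users_def)
  have decode: "dec c b (m b) (hist h1 h2 h3 c m w n b) a = m a b" if "(a, b) \<in> pairs" "w \<in> G m" for a b m w
    using that unfolding G_def err_event_def by blast
  have msg1: "m a b = 1" if "m \<in> ?M" "(a, b) \<notin> pairs" for m a b
    using that unfolding msgs_def mem_Collect_eq by metis
  have bound: "ln K \<le> (real n * B + 1) / (1 - perr h1 h2 h3 n R c) - ln (1 - perr h1 h2 h3 n R c)"
  \<comment> \<open>\<open>v\<close> collects both messages of user \<open>j\<close> and the message
    from \<open>l\<close> to \<open>k\<close>; \<open>K\<close> counts the values of the other
    three.\<close>
  proof (rule shear_converse[where I="I n" and M="?M" and G=G and v="\<lambda>m. (m j k, m j l, m l k)" and s=s and \<sigma>=\<sigma> and r=r])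
    show "finite (I n)" by (simp add: I_def)
    show "G m \<in> sets (gnoise (I n))" if "m \<in> ?M" for m
      unfolding G_def noise[symmetric] using err[OF that] by auto
    show "m = m'" if m: "m \<in> ?M" "m' \<in> ?M" and v: "(m j k, m j l, m l k) = (m' j k, m' j l, m' l k)"
      and w: "w \<in> G m" "w' \<in> G m'" and sh: "shear (I n) (s m) w = shear (I n) (s m') w'" for m m' w w'
    proof -
      have same: "m a b = m' a b" if "(a, b) \<notin> pairs" for a b
        using m that by (simp add: msg1)
      have "m j b = m' j b" for b
        using v same[of j b] jkl by (cases "b = k \<or> b = l") (auto simp: pairs)
      then have mj: "m j = m' j" by blast
      note rec = recover[OF mj sh]
      have kj: "m k j = m' k j" and lj: "m l j = m' l j"
        using decode[of k j w m] decode[of k j w' m'] decode[of l j w m] decode[of l j w' m'] w rec mj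
        by (auto simp: pairs)
      \<comment> \<open>Both messages of user \<open>l\<close> must agree before its decoder can be
        compared, since they are inputs of that decoder.\<close>
      have "m l b = m' l b" for b
        using v lj same[of l b] jkl by (cases "b = k \<or> b = j") (auto simp: pairs)
      then have ml: "m l = m' l" by blast
      have kl: "m k l = m' k l"
        using decode[of k l w m] decode[of k l w' m'] w rec ml by (auto simp: pairs)
      have "m k b = m' k b" for b
        using kj kl same[of k b] jkl by (cases "b = l \<or> b = j") (auto simp: pairs)
      then have mk: "m k = m' k" by blast
      have "m a b = m' a b" for a b
        using mj ml mk same[of a b] jkl by (cases "a = j \<or> a = l \<or> a = k") (auto simp: pairs)
      then show ?thesis by blast
    qed
    show "K > 0" by (simp add: K_def nmsg_pos)
    have "(\<lambda>m. (m j k, m j l, m l k)) ` ?M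
      \<subseteq> {1..nmsg n (R j k)} \<times> {1..nmsg n (R j l)} \<times> {1..nmsg n (R l k)}"
    proof (rule image_subsetI)
      fix m assume "m \<in> ?M"
      then have "m a b \<in> {1..nmsg n (R a b)}" if "(a, b) \<in> pairs" for a b
        using that unfolding msgs_def mem_Collect_eq by metis
      then show "(m j k, m j l, m l k) \<in> {1..nmsg n (R j k)} \<times> {1..nmsg n (R j l)} \<times> {1..nmsg n (R l k)}"
        by (simp add: pairs)
    qed
    from card_mono[OF _ this] have "card ((\<lambda>m. (m j k, m j l, m l k)) ` ?M)
      \<le> nmsg n (R j k) * nmsg n (R j l) * nmsg n (R l k)"
      by (simp add: card_cartesian_product mult.assoc)
    then have "real (card ((\<lambda>m. (m j k, m j l, m l k)) ` ?M)) * K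
      \<le> real (nmsg n (R j k) * nmsg n (R j l) * nmsg n (R l k)) * K"
      by (intro mult_right_mono) (auto simp: K_def simp del: of_nat_mult)
    also have "\<dots> = real (card ?M)"
      using jkl unfolding card_msgs pairs K_def by (simp add: mult_ac)
    finally show "real (card ((\<lambda>m. (m j k, m j l, m l k)) ` ?M)) * K \<le> real (card ?M)" .
    let ?e = "\<lambda>m a i. \<integral>w. (inp h1 h2 h3 c m w a i)\<^sup>2 \<partial>gnoise (I n)"
    \<comment> \<open>The power constraint is an average over messages and time, so only the double
      sum of the excess has a sign.\<close>
    have pow: "(\<Sum>m\<in>?M. \<Sum>i<n. ?e m a i - P) \<le> 0" if "a \<in> {0..3}" for a
    proof -
      have "(1 / real n) * (\<Sum>i<n. (\<Sum>m\<in>?M. ?e m a i) / real (card ?M)) \<le> P"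
        using valid that unfolding valid_code_def avg_power_def noise by blast
      moreover have "(\<Sum>i<n. (\<Sum>m\<in>?M. ?e m a i) / real (card ?M)) = (\<Sum>m\<in>?M. \<Sum>i<n. ?e m a i) / real (card ?M)"
        by (subst sum.swap) (simp add: sum_divide_distrib)
      ultimately have "(\<Sum>m\<in>?M. \<Sum>i<n. ?e m a i) \<le> real (card ?M) * (real n * P)"
        using cM n by (simp add: field_simps)
      then show ?thesis by (simp add: sum_subtractf)
    qed
    have "(\<Sum>m\<in>?M. \<Sum>t\<in>I n. ln (\<sigma> t) - 1 / 2 + ((\<integral>w. (s m t w)\<^sup>2 \<partial>gnoise (I n)) + 1) / (2 * (\<sigma> t)\<^sup>2))
      = (\<Sum>m\<in>?M. \<Sum>i<n. \<Sum>a\<in>{0..3}. ln (\<sigma> (a, i)) - 1 / 2 + ((\<integral>w. (s m (a, i) w)\<^sup>2 \<partial>gnoise (I n)) + 1) / (2 * (\<sigma> (a, i))\<^sup>2))"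
      by (subst (2) sum.swap) (simp add: I_def sum.cartesian_product split_beta')
    also have "\<dots> \<le> (\<Sum>m\<in>?M. \<Sum>i<n. B + (\<Sum>a\<in>{0..3}. \<kappa> a * (?e m a i - P)))"
      by (intro sum_mono energy) auto
    also have "\<dots> = card ?M * (real n * B) + (\<Sum>m\<in>?M. \<Sum>i<n. \<Sum>a\<in>{0..3}. \<kappa> a * (?e m a i - P))"
      by (simp add: sum.distrib)
    also have "(\<Sum>m\<in>?M. \<Sum>i<n. \<Sum>a\<in>{0..3}. \<kappa> a * (?e m a i - P))
      = (\<Sum>m\<in>?M. \<Sum>a\<in>{0..3}. \<Sum>i<n. \<kappa> a * (?e m a i - P))"
      by (intro sum.cong refl sum.swap)
    also have "\<dots> = (\<Sum>a\<in>{0..3}. \<Sum>m\<in>?M. \<Sum>i<n. \<kappa> a * (?e m a i - P))"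
      by (rule sum.swap)
    also have "\<dots> = (\<Sum>a\<in>{0..3}. \<kappa> a * (\<Sum>m\<in>?M. \<Sum>i<n. ?e m a i - P))"
      by (simp only: sum_distrib_left)
    also have "\<dots> \<le> 0"
      by (intro sum_nonpos mult_nonneg_nonpos \<kappa> pow)
    finally show "(\<Sum>m\<in>?M. \<Sum>t\<in>I n. ln (\<sigma> t) - 1 / 2 + ((\<integral>w. (s m t w)\<^sup>2 \<partial>gnoise (I n)) + 1) / (2 * (\<sigma> t)\<^sup>2))
      \<le> card ?M * (real n * B)" by simp
    have "(\<Sum>m\<in>?M. measure (noise n) (G m)) = (\<Sum>m\<in>?M. 1 - measure (noise n) (err_event h1 h2 h3 n c m))"
      unfolding G_def by (intro sum.cong refl prob_compl err)
    also have "\<dots> = card ?M * (1 - perr h1 h2 h3 n R c)"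
      using cM by (simp add: perr_def sum_subtractf field_simps)
    finally show "(\<Sum>m\<in>?M. measure (gnoise (I n)) (G m)) = card ?M * (1 - perr h1 h2 h3 n R c)"
      unfolding noise .
  qed (use causal s2 \<sigma> perr finite_msgs msgs_nonempty in auto)
  have "real n * (R k j + R l j + R k l) * ln 2 = ln (2 powr (real n * (R k j + R l j + R k l)))"
    by (simp add: ln_powr)
  also have "2 powr (real n * (R k j + R l j + R k l))
    = 2 powr (real n * R k j) * 2 powr (real n * R l j) * 2 powr (real n * R k l)"
    by (simp add: distrib_left powr_add)
  \<comment> \<open>Rounding up in \<open>nmsg\<close> can only enlarge \<open>K\<close>.\<close>
  also have "ln \<dots> \<le> ln K"
  proof -
    have "2 powr (real n * R k j) * 2 powr (real n * R l j) * 2 powr (real n * R k l) \<le> K"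
      unfolding K_def of_nat_mult by (intro mult_mono nmsg_ge) auto
    moreover have "0 < 2 powr (real n * R k j) * 2 powr (real n * R l j) * 2 powr (real n * R k l)" by simp
    ultimately show ?thesis by (subst ln_le_cancel_iff) linarith+
  qed
  also note bound
  finally show ?thesis .
qed

text \<open>After division by \<open>n\<close>, the additive 1 and the logarithm vanish in the
  limit, and the factor \<open>1 / (1 - p n)\<close> tends to 1.\<close>

lemma asymptotic_rate_bound:
  fixes x B :: real and p :: "nat \<Rightarrow> real"
  assumes "p \<longlonglongrightarrow> 0"
    and "\<And>n. n > 0 \<Longrightarrow> p n < 1 \<Longrightarrow> real n * x \<le> (real n * B + 1) / (1 - p n) - ln (1 - p n)"
  shows "x \<le> B"
proof (rule tendsto_le[OF sequentially_bot _ tendsto_const])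
  have q: "(\<lambda>n. 1 - p n) \<longlonglongrightarrow> 1"
    using tendsto_diff[OF tendsto_const[of 1] assms(1)] by simp
  have "(\<lambda>n. (B + inverse (real n)) / (1 - p n) - ln (1 - p n) * inverse (real n)) \<longlonglongrightarrow> (B + 0) / 1 - ln 1 * 0"
    by (intro tendsto_intros q lim_inverse_n) auto
  then show "(\<lambda>n. (B + inverse (real n)) / (1 - p n) - ln (1 - p n) * inverse (real n)) \<longlonglongrightarrow> B"
    by simp
  have "eventually (\<lambda>n. p n < 1) sequentially"
    using assms(1) by (rule order_tendstoD) simp
  then show "eventually (\<lambda>n. x \<le> (B + inverse (real n)) / (1 - p n) - ln (1 - p n) * inverse (real n)) sequentially"
    using eventually_gt_at_top[of 0]
  proof eventually_elim
    case (elim n)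
    have "x \<le> ((real n * B + 1) / (1 - p n) - ln (1 - p n)) * inverse (real n)"
      using assms(2)[OF elim(2,1)] elim by (simp add: field_simps)
    also have "\<dots> = (B + inverse (real n)) / (1 - p n) - ln (1 - p n) * inverse (real n)"
      using elim by (simp add: field_simps)
    finally show ?case .
  qed
qed

section \<open>The two cuts for a fixed code\<close>

lemma three_users:
  assumes "j \<in> users" "k \<in> users" "l \<in> users" "j \<noteq> k" "j \<noteq> l" "k \<noteq> l"
  shows sum_users: "(\<Sum>b\<in>users. f b) = f j + (f k + (f l :: real))"
    and sum_nodes: "(\<Sum>a\<in>{0..3}. f a) = f 0 + (f j + (f k + (f l :: real)))"
    and users_nonzero: "j \<noteq> 0" "k \<noteq> 0" "l \<noteq> 0"
    and users_nodes: "j \<in> {0..3}" "k \<in> {0..3}" "l \<in> {0..3}"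
proof -
  have u: "users = {j, k, l}" "{0..3} = {0, j, k, l}" "j \<noteq> 0" "k \<noteq> 0" "l \<noteq> 0"
    using assms by (auto simp: users_def)
  show "(\<Sum>b\<in>users. f b) = f j + (f k + f l)"
    unfolding u(1) using assms by simp
  show "(\<Sum>a\<in>{0..3}. f a) = f 0 + (f j + (f k + f l))"
    unfolding u(2) using assms u(3-5) by simp
  show "j \<noteq> 0" "k \<noteq> 0" "l \<noteq> 0" by fact+
  show "j \<in> {0..3}" "k \<in> {0..3}" "l \<in> {0..3}" using u(2) by auto
qed

lemma hist_user:
  assumes "b \<in> users"
  shows "hist h1 h2 h3 c m w i b = map (\<lambda>i. gain h1 h2 h3 b * inp h1 h2 h3 c m w 0 i + w (b, i)) [0..<i]"
proof (induction i)
  case (Suc i)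
  have "b \<noteq> 0" using assms by (auto simp: users_def)
  then show ?case using assms Suc by (simp add: Let_def inp_def)
qed simp

text \<open>Given the relay input, users \<open>j\<close> and \<open>l\<close> observe it through
  two gains in independent noise, like one receiver with two antennas. The argument of the logarithm
  is the determinant of the output covariance at full relay power.\<close>

lemma broadcast_code_bound:
  fixes P :: real
  assumes valid: "valid_code h1 h2 h3 P n R c" and n: "n > 0" and P: "P > 0"
    and jkl: "j \<in> users" "k \<in> users" "l \<in> users" "j \<noteq> k" "j \<noteq> l" "k \<noteq> l"
    and perr: "perr h1 h2 h3 n R c < 1"
  shows "real n * (R k j + R l j + R k l) * ln 2
    \<le> (real n * (ln (1 + ((gain h1 h2 h3 j)\<^sup>2 + (gain h1 h2 h3 l)\<^sup>2) * P) / 2) + 1) / (1 - perr h1 h2 h3 n R c)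
      - ln (1 - perr h1 h2 h3 n R c)"
proof -
  let ?I = "{0..3::nat} \<times> {..<n}"
  let ?gj = "gain h1 h2 h3 j" and ?gl = "gain h1 h2 h3 l"
  let ?x = "\<lambda>m w i. inp h1 h2 h3 c m w 0 i"
  note nz = users_nonzero[OF jkl] and nodes = users_nodes[OF jkl]
  \<comment> \<open>At relay power \<open>P\<close>, \<open>A\<close> is the reference variance of
    the output at \<open>j\<close>, \<open>T\<close> the determinant of the joint covariance, and
    \<open>d\<close> the regression coefficient of the output at \<open>l\<close> on the output at
    \<open>j\<close>.\<close>
  define A where "A = 1 + ?gj\<^sup>2 * P"
  define T where "T = 1 + (?gj\<^sup>2 + ?gl\<^sup>2) * P"
  define d where "d = P * ?gl * ?gj / A"
  have A: "A > 0" and T: "T > 0"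
    using P by (auto simp: A_def T_def intro!: add_pos_nonneg)
  \<comment> \<open>Subtracting \<open>d\<close> times the output at \<open>j\<close> reduces the
    relay gain at \<open>l\<close> to \<open>?gl / A\<close>.\<close>
  have gl: "?gl = ?gl / A + d * ?gj"
    using A by (simp add: d_def field_simps) (simp add: A_def algebra_simps power2_eq_square)
  \<comment> \<open>The innovation at \<open>l\<close> has three parts: the reduced signal, the
    noise of \<open>j\<close> scaled by \<open>d\<close>, and its own noise. At full power its
    variance is determinant over \<open>A\<close>.\<close>
  have var_l: "(?gl / A)\<^sup>2 * P + d\<^sup>2 + 1 = T / A"
  proof -
    have "(?gl / A)\<^sup>2 * P + d\<^sup>2 = ?gl\<^sup>2 * P * (1 + ?gj\<^sup>2 * P) / A\<^sup>2"
      by (simp add: d_def power_divide power_mult_distrib add_divide_distrib[symmetric] algebra_simps power2_eq_square)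
    also have "\<dots> = ?gl\<^sup>2 * P / A"
      using A unfolding A_def[symmetric] by (simp add: power2_eq_square)
    finally show ?thesis using A by (simp add: T_def field_simps) (simp add: A_def algebra_simps)
  qed
  \<comment> \<open>The reference law of the outputs of j and l has covariance 1 + P g g^T. Replacing Y_l by Y_l - d Y_j
    decorrelates it; the unobserved nodes contribute their bare noise.\<close>
  define s where "s m t w = (if fst t = j then ?gj * ?x m w (snd t)
    else if fst t = l then ?gl / A * ?x m w (snd t) - d * w (j, snd t) else 0)" for m and t :: "nat \<times> nat" and w
  define \<sigma> where "\<sigma> t = (if fst t = j then sqrt A else if fst t = l then sqrt (T / A) else 1)" for t :: "nat \<times> nat"
  define \<kappa> where "\<kappa> a = (if a = 0 then ?gj\<^sup>2 / (2 * A) + (?gl / A)\<^sup>2 / (2 * (T / A)) else 0)" for a :: nat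
  have noise: "noise n = gnoise ?I" by (simp add: noise_def)
  have xm: "(\<lambda>w. ?x m w i) \<in> borel_measurable (gnoise ?I)"
    and x2: "integrable (gnoise ?I) (\<lambda>w. (?x m w i)\<^sup>2)" if "m \<in> msgs n R" "i < n" for m i
    using valid that unfolding valid_code_def noise by auto
  have sj: "s m (j, i) = (\<lambda>w. ?gj * ?x m w i)" and sl: "s m (l, i) = (\<lambda>w. ?gl / A * ?x m w i - d * w (j, i))"
    and s0: "s m (0, i) = (\<lambda>w. 0)" and sk: "s m (k, i) = (\<lambda>w. 0)" for m i
    using nz jkl by (auto simp: s_def)
  have w2: "integrable (gnoise ?I) (\<lambda>w. (w (j, i))\<^sup>2)" "(\<integral>w. (w (j, i))\<^sup>2 \<partial>gnoise ?I) = 1" if "i < n" for i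
    using that nodes by (auto intro!: gnoise_component_moments simp del: atLeastAtMost_iff)
  \<comment> \<open>The relay input at time \<open>i\<close> is formed before the noise of time
    \<open>i\<close>.\<close>
  have xw: "integrable (gnoise ?I) (\<lambda>w. ?x m w i * w (j, i))" "(\<integral>w. ?x m w i * w (j, i) \<partial>gnoise ?I) = 0"
    if m: "m \<in> msgs n R" and i: "i < n" for m i
    using nodes(1) i by (auto intro!: gnoise_uncorrelated xm[OF m] x2[OF m] inp_cong simp del: atLeastAtMost_iff)
  have sl2_eq: "(?gl / A * x - d * z)\<^sup>2 = (?gl / A)\<^sup>2 * x\<^sup>2 - 2 * (?gl / A) * d * (x * z) + d\<^sup>2 * z\<^sup>2" for x z
    by (simp add: power2_eq_square algebra_simps)
  have sl2: "integrable (gnoise ?I) (\<lambda>w. (?gl / A * ?x m w i - d * w (j, i))\<^sup>2)"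
    "(\<integral>w. (?gl / A * ?x m w i - d * w (j, i))\<^sup>2 \<partial>gnoise ?I) = (?gl / A)\<^sup>2 * (\<integral>w. (?x m w i)\<^sup>2 \<partial>gnoise ?I) + d\<^sup>2"
    if m: "m \<in> msgs n R" and i: "i < n" for m i
    unfolding sl2_eq using x2[OF m i] w2[OF i] xw[OF m i] by simp_all
  have "real n * (R k j + R l j + R k l) * ln 2 \<le> (real n * (ln T / 2) + 1) / (1 - perr h1 h2 h3 n R c) - ln (1 - perr h1 h2 h3 n R c)"
  \<comment> \<open>At equal times \<open>l\<close> ranks just above the other nodes, because its
    decorrelated signal reads the noise of \<open>j\<close> at the same time.\<close>
  proof (rule code_converse[OF valid n jkl, where s=s and \<sigma>=\<sigma> and \<kappa>=\<kappa> and r="\<lambda>t. 2 * snd t + (if fst t = l then 1 else 0)"])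
    fix m assume m: "m \<in> msgs n R"
    show "causal (\<lambda>t. 2 * snd t + (if fst t = l then 1 else 0)) ?I (s m)"
      unfolding causal_def
    proof (intro ballI conjI allI impI)
      fix t assume t: "t \<in> ?I"
      then have i: "snd t < n" by auto
      have [measurable]: "(\<lambda>w. w (j, snd t)) \<in> borel_measurable (PiM ?I (\<lambda>_. borel :: real measure))"
        using i nodes by (intro measurable_component_singleton) auto
      have [measurable]: "(\<lambda>w. ?x m w (snd t)) \<in> borel_measurable (PiM ?I (\<lambda>_. borel))"
        using xm[OF m i] unfolding measurable_gnoise .
      show "s m t \<in> borel_measurable (PiM ?I (\<lambda>_. borel))"
        unfolding s_def by measurable
      fix w w' :: "nat \<times> nat \<Rightarrow> real"
      assume eq: "\<forall>v\<in>?I. 2 * snd v + (if fst v = l then 1 else 0) < 2 * snd t + (if fst t = l then 1 else 0) \<longrightarrow> w v = w' v"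
      have "?x m w (snd t) = ?x m w' (snd t)"
        using i by (intro inp_cong eq[rule_format]) auto
      moreover have "w (j, snd t) = w' (j, snd t)" if "fst t = l"
        using i that nodes jkl by (intro eq[rule_format]) auto
      ultimately show "s m t w = s m t w'" by (auto simp: s_def)
    qed
    show "integrable (gnoise ?I) (\<lambda>w. (s m t w)\<^sup>2)" if tI: "t \<in> ?I" for t
    proof -
      obtain a i where t: "t = (a, i)" "i < n" using tI by auto
      consider "a = j" | "a = l" | "a \<noteq> j" "a \<noteq> l" by blast
      then show ?thesis
        using x2[OF m t(2)] sl2(1)[OF m t(2)] by cases (simp_all add: t sj sl power_mult_distrib, simp add: s_def)
    qed
    fix i assume i: "i < n"
    define e where "e = (\<integral>w. (?x m w i)\<^sup>2 \<partial>gnoise ?I)"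
    \<comment> \<open>Nodes 0 and \<open>k\<close> carry bare noise of unit variance and contribute
      \<open>ln 1 - 1 / 2 + 1 / 2 = 0\<close>.\<close>
    have "(\<Sum>a\<in>{0..3}. ln (\<sigma> (a, i)) - 1 / 2 + ((\<integral>w. (s m (a, i) w)\<^sup>2 \<partial>gnoise ?I) + 1) / (2 * (\<sigma> (a, i))\<^sup>2))
      = (ln (sqrt A) - 1 / 2 + (?gj\<^sup>2 * e + 1) / (2 * A))
        + (ln (sqrt (T / A)) - 1 / 2 + ((?gl / A)\<^sup>2 * e + d\<^sup>2 + 1) / (2 * (T / A)))"
      unfolding sum_nodes[OF jkl] sj sl s0 sk sl2(2)[OF m i] using nz jkl A T
      by (simp add: \<sigma>_def power_mult_distrib e_def)
    \<comment> \<open>At \<open>e = P\<close> both variances equal their reference values, so the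
      quadratic terms cancel the two halves; what remains is a multiple of
      \<open>e - P\<close>.\<close>
    also have "\<dots> = ln T / 2 + (?gj\<^sup>2 / (2 * A) + (?gl / A)\<^sup>2 / (2 * (T / A))) * (e - P)"
    proof -
      have 1: "(?gj\<^sup>2 * e + 1) / (2 * A) = 1 / 2 + ?gj\<^sup>2 / (2 * A) * (e - P)"
      proof -
        have "?gj\<^sup>2 * e + 1 = A + ?gj\<^sup>2 * (e - P)" by (simp add: A_def algebra_simps)
        then show ?thesis using A by (simp add: field_simps)
      qed
      have 2: "((?gl / A)\<^sup>2 * e + d\<^sup>2 + 1) / (2 * (T / A)) = 1 / 2 + (?gl / A)\<^sup>2 / (2 * (T / A)) * (e - P)"
      proof -
        have "(?gl / A)\<^sup>2 * e + d\<^sup>2 + 1 = T / A + (?gl / A)\<^sup>2 * (e - P)"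
          unfolding var_l[symmetric] by (simp add: algebra_simps)
        moreover have "T / A \<noteq> 0" using A T by simp
        ultimately show ?thesis by (simp only: add_divide_distrib) simp
      qed
      have 3: "ln (sqrt A) + ln (sqrt (T / A)) = ln T / 2"
        using A T by (simp add: ln_sqrt ln_div diff_divide_distrib)
      show ?thesis unfolding 1 2 distrib_right using 3 by linarith
    qed
    also have "\<dots> = ln T / 2 + (\<Sum>a\<in>{0..3}. \<kappa> a * ((\<integral>w. (inp h1 h2 h3 c m w a i)\<^sup>2 \<partial>gnoise ?I) - P))"
      unfolding sum_nodes[OF jkl] using nz jkl by (simp add: \<kappa>_def e_def)
    finally show "(\<Sum>a\<in>{0..3}. ln (\<sigma> (a, i)) - 1 / 2 + ((\<integral>w. (s m (a, i) w)\<^sup>2 \<partial>gnoise ?I) + 1) / (2 * (\<sigma> (a, i))\<^sup>2))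
      \<le> ln T / 2 + (\<Sum>a\<in>{0..3}. \<kappa> a * ((\<integral>w. (inp h1 h2 h3 c m w a i)\<^sup>2 \<partial>gnoise ?I) - P))" by simp
  next
    show "\<sigma> t > 0" for t using A T by (simp add: \<sigma>_def)
    show "\<kappa> a \<ge> 0" for a using A T by (simp add: \<kappa>_def)
    fix m m' and w w' :: "nat \<times> nat \<Rightarrow> real"
    assume sh: "shear ?I (s m) w = shear ?I (s m') w'"
    have y: "s m (a, i) w + w (a, i) = s m' (a, i) w' + w' (a, i)" if "a \<in> {0..3}" "i < n" for a i
      using fun_cong[OF sh, of "(a, i)"] that by (simp add: shear_def)
    have yj: "?gj * ?x m w i + w (j, i) = ?gj * ?x m' w' i + w' (j, i)" if "i < n" for i
      using y[of j i] that nodes by (simp add: sj)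
    \<comment> \<open>Adding \<open>d\<close> times the output at \<open>j\<close> undoes the
      decorrelation.\<close>
    have yl: "?gl * ?x m w i + w (l, i) = ?gl * ?x m' w' i + w' (l, i)" if "i < n" for i
    proof -
      have e: "?gl * x + z = (?gl / A * x - d * z' + z) + d * (?gj * x + z')" for x z z'
      proof -
        have "?gl * x = (?gl / A + d * ?gj) * x" using gl by simp
        then show ?thesis by (simp add: algebra_simps)
      qed
      show ?thesis
        unfolding e[of "?x m w i" "w (l, i)" "w (j, i)"] e[of "?x m' w' i" "w' (l, i)" "w' (j, i)"]
        using y[of l i] that nodes yj[OF that] by (simp add: sl)
    qed
    show "hist h1 h2 h3 c m w n j = hist h1 h2 h3 c m' w' n j \<and> hist h1 h2 h3 c m w n l = hist h1 h2 h3 c m' w' n l"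
      unfolding hist_user[OF jkl(1)] hist_user[OF jkl(3)] using yj yl by simp
  qed (rule perr)
  then show ?thesis unfolding T_def .
qed

text \<open>Feedback may correlate the inputs of \<open>k\<close> and \<open>l\<close>, so their
  signals are allowed to add coherently at the relay; hence the squared sum of the absolute gains.
  Once the past relay outputs are known, the outputs of \<open>j\<close> and \<open>l\<close> add
  only noise and cost nothing.\<close>

lemma multiple_access_code_bound:
  fixes P :: real
  assumes valid: "valid_code h1 h2 h3 P n R c" and n: "n > 0" and P: "P > 0"
    and jkl: "j \<in> users" "k \<in> users" "l \<in> users" "j \<noteq> k" "j \<noteq> l" "k \<noteq> l"
    and perr: "perr h1 h2 h3 n R c < 1"
  shows "real n * (R k j + R l j + R k l) * ln 2
    \<le> (real n * (ln (1 + (\<bar>gain h1 h2 h3 k\<bar> + \<bar>gain h1 h2 h3 l\<bar>)\<^sup>2 * P) / 2) + 1) / (1 - perr h1 h2 h3 n R c)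
      - ln (1 - perr h1 h2 h3 n R c)"
proof -
  let ?I = "{0..3::nat} \<times> {..<n}"
  let ?gk = "gain h1 h2 h3 k" and ?gl = "gain h1 h2 h3 l"
  let ?x = "\<lambda>m w a i. inp h1 h2 h3 c m w a i"
  note nz = users_nonzero[OF jkl] and nodes = users_nodes[OF jkl]
  define g where "g = \<bar>?gk\<bar> + \<bar>?gl\<bar>"
  define T where "T = 1 + g\<^sup>2 * P"
  have T: "T > 0" and g: "g \<ge> 0"
    using P by (auto simp: T_def g_def intro!: add_pos_nonneg)
  \<comment> \<open>The relay coordinate is Y_r minus the contribution of user j. Together with the noise at j and l it
    determines the outputs of r, j and l recursively, because X_j depends on Y_j and m_j only.\<close>
  define s where "s m t w = (if fst t = 0 then ?gk * ?x m w k (snd t) + ?gl * ?x m w l (snd t) else 0)"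
    for m and t :: "nat \<times> nat" and w
  define \<sigma> where "\<sigma> t = (if fst t = 0 then sqrt T else 1)" for t :: "nat \<times> nat"
  \<comment> \<open>The total weight \<open>g\<^sup>2 / (2 * T)\<close> is split between
    \<open>k\<close> and \<open>l\<close> in proportion to their absolute gains, matching the
    coefficients in \<open>s2_le\<close>.\<close>
  define \<kappa> where "\<kappa> a = (if a = k then g * \<bar>?gk\<bar> / (2 * T) else if a = l then g * \<bar>?gl\<bar> / (2 * T) else 0)" for a :: nat
  have noise: "noise n = gnoise ?I" by (simp add: noise_def)
  have xm: "(\<lambda>w. ?x m w a i) \<in> borel_measurable (gnoise ?I)"
    and x2: "integrable (gnoise ?I) (\<lambda>w. (?x m w a i)\<^sup>2)" if "m \<in> msgs n R" "i < n" "a \<in> {0..3}" for m i a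
    using valid that unfolding valid_code_def noise by auto
  note kl = nodes(2,3)
  have s0: "s m (0, i) = (\<lambda>w. ?gk * ?x m w k i + ?gl * ?x m w l i)" for m i
    by (auto simp: s_def)
  have sa: "s m (a, i) = (\<lambda>w. 0)" if "a \<noteq> 0" for m a i
    using that by (auto simp: s_def)
  \<comment> \<open>Cauchy-Schwarz weighted by the absolute gains, which makes the bound linear in
    the two powers. For nonnegative \<open>a\<close> and \<open>b\<close> the gap is
    \<open>a * b * (p - q)\<^sup>2\<close>.\<close>
  have s2_le: "(?gk * x + ?gl * z)\<^sup>2 \<le> g * (\<bar>?gk\<bar> * x\<^sup>2 + \<bar>?gl\<bar> * z\<^sup>2)" for x z
  proof -
    have "(a * p + b * q)\<^sup>2 \<le> (a + b) * (a * p\<^sup>2 + b * q\<^sup>2)" if "a \<ge> 0" "b \<ge> 0" for a b p q :: real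
      using mult_nonneg_nonneg[OF mult_nonneg_nonneg[OF that] zero_le_power2[of "p - q"]]
      by (simp add: power2_eq_square algebra_simps)
    from this[of "\<bar>?gk\<bar>" "\<bar>?gl\<bar>" "\<bar>x\<bar>" "\<bar>z\<bar>"]
    have "(\<bar>?gk\<bar> * \<bar>x\<bar> + \<bar>?gl\<bar> * \<bar>z\<bar>)\<^sup>2 \<le> g * (\<bar>?gk\<bar> * x\<^sup>2 + \<bar>?gl\<bar> * z\<^sup>2)"
      by (simp add: g_def)
    moreover have "\<bar>?gk * x + ?gl * z\<bar> \<le> \<bar>?gk\<bar> * \<bar>x\<bar> + \<bar>?gl\<bar> * \<bar>z\<bar>"
      using abs_triangle_ineq[of "?gk * x" "?gl * z"] by (simp add: abs_mult)
    then have "(?gk * x + ?gl * z)\<^sup>2 \<le> (\<bar>?gk\<bar> * \<bar>x\<bar> + \<bar>?gl\<bar> * \<bar>z\<bar>)\<^sup>2"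
      by (rule abs_le_square_iff[THEN iffD1, OF order_trans]) simp
    ultimately show ?thesis by simp
  qed
  have s2: "integrable (gnoise ?I) (\<lambda>w. (?gk * ?x m w k i + ?gl * ?x m w l i)\<^sup>2)"
    "(\<integral>w. (?gk * ?x m w k i + ?gl * ?x m w l i)\<^sup>2 \<partial>gnoise ?I)
      \<le> g * (\<bar>?gk\<bar> * (\<integral>w. (?x m w k i)\<^sup>2 \<partial>gnoise ?I) + \<bar>?gl\<bar> * (\<integral>w. (?x m w l i)\<^sup>2 \<partial>gnoise ?I))"
    if m: "m \<in> msgs n R" and i: "i < n" for m i
  proof -
    note [measurable] = xm[OF m i kl(1)] xm[OF m i kl(2)]
    have b: "integrable (gnoise ?I) (\<lambda>w. g * (\<bar>?gk\<bar> * (?x m w k i)\<^sup>2 + \<bar>?gl\<bar> * (?x m w l i)\<^sup>2))"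
      using x2[OF m i kl(1)] x2[OF m i kl(2)] by simp
    show 1: "integrable (gnoise ?I) (\<lambda>w. (?gk * ?x m w k i + ?gl * ?x m w l i)\<^sup>2)"
      by (rule Bochner_Integration.integrable_bound[OF b]) (auto intro!: AE_I2 s2_le[THEN order_trans])
    have "(\<integral>w. (?gk * ?x m w k i + ?gl * ?x m w l i)\<^sup>2 \<partial>gnoise ?I)
      \<le> (\<integral>w. g * (\<bar>?gk\<bar> * (?x m w k i)\<^sup>2 + \<bar>?gl\<bar> * (?x m w l i)\<^sup>2) \<partial>gnoise ?I)"
      by (rule integral_mono[OF 1 b s2_le])
    then show "(\<integral>w. (?gk * ?x m w k i + ?gl * ?x m w l i)\<^sup>2 \<partial>gnoise ?I)
      \<le> g * (\<bar>?gk\<bar> * (\<integral>w. (?x m w k i)\<^sup>2 \<partial>gnoise ?I) + \<bar>?gl\<bar> * (\<integral>w. (?x m w l i)\<^sup>2 \<partial>gnoise ?I))"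
      using x2[OF m i kl(1)] x2[OF m i kl(2)] by simp
  qed
  have "real n * (R k j + R l j + R k l) * ln 2 \<le> (real n * (ln T / 2) + 1) / (1 - perr h1 h2 h3 n R c) - ln (1 - perr h1 h2 h3 n R c)"
  \<comment> \<open>No signal here reads noise of its own time, so time alone serves as the
    rank.\<close>
  proof (rule code_converse[OF valid n jkl, where s=s and \<sigma>=\<sigma> and \<kappa>=\<kappa> and r=snd])
    fix m assume m: "m \<in> msgs n R"
    show "causal snd ?I (s m)"
      unfolding causal_def
    proof (intro ballI conjI allI impI)
      fix t assume t: "t \<in> ?I"
      then have i: "snd t < n" by auto
      have [measurable]: "(\<lambda>w. ?x m w a (snd t)) \<in> borel_measurable (PiM ?I (\<lambda>_. borel))" if "a \<in> {0..3}" for a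
        using xm[OF m i that] unfolding measurable_gnoise .
      show "s m t \<in> borel_measurable (PiM ?I (\<lambda>_. borel))"
        unfolding s_def using kl by measurable
      fix w w' :: "nat \<times> nat \<Rightarrow> real"
      assume eq: "\<forall>v\<in>?I. snd v < snd t \<longrightarrow> w v = w' v"
      have "?x m w a (snd t) = ?x m w' a (snd t)" for a
        using i by (intro inp_cong eq[rule_format]) auto
      then show "s m t w = s m t w'" by (simp add: s_def)
    qed
    show "integrable (gnoise ?I) (\<lambda>w. (s m t w)\<^sup>2)" if "t \<in> ?I" for t
      using that s2(1)[OF m, of "snd t"] by (cases "fst t = 0") (auto simp: s_def)
    fix i assume i: "i < n"
    define ek where "ek = (\<integral>w. (?x m w k i)\<^sup>2 \<partial>gnoise ?I)"
    define el where "el = (\<integral>w. (?x m w l i)\<^sup>2 \<partial>gnoise ?I)"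
    have "(\<Sum>a\<in>{0..3}. ln (\<sigma> (a, i)) - 1 / 2 + ((\<integral>w. (s m (a, i) w)\<^sup>2 \<partial>gnoise ?I) + 1) / (2 * (\<sigma> (a, i))\<^sup>2))
      = ln T / 2 - 1 / 2 + ((\<integral>w. (?gk * ?x m w k i + ?gl * ?x m w l i)\<^sup>2 \<partial>gnoise ?I) + 1) / (2 * T)"
      unfolding sum_nodes[OF jkl] s0 sa[OF nz(1)] sa[OF nz(2)] sa[OF nz(3)] using nz jkl T
      by (simp add: \<sigma>_def ln_sqrt)
    also have "\<dots> \<le> ln T / 2 - 1 / 2 + (g * (\<bar>?gk\<bar> * ek + \<bar>?gl\<bar> * el) + 1) / (2 * T)"
      using s2(2)[OF m i] T unfolding ek_def el_def by (intro add_left_mono divide_right_mono) auto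
    also have "\<dots> = ln T / 2 + (g * \<bar>?gk\<bar> / (2 * T) * (ek - P) + g * \<bar>?gl\<bar> / (2 * T) * (el - P))"
    proof -
      have *: "g * (\<bar>?gk\<bar> * ek + \<bar>?gl\<bar> * el) + 1 = T + (g * \<bar>?gk\<bar> * (ek - P) + g * \<bar>?gl\<bar> * (el - P))"
      proof -
        have "T = 1 + g * (\<bar>?gk\<bar> + \<bar>?gl\<bar>) * P" by (simp add: T_def g_def power2_eq_square)
        then show ?thesis by (simp add: algebra_simps)
      qed
      show ?thesis unfolding * using T by (simp add: add_divide_distrib)
    qed
    also have "\<dots> = ln T / 2 + (\<Sum>a\<in>{0..3}. \<kappa> a * ((\<integral>w. (?x m w a i)\<^sup>2 \<partial>gnoise ?I) - P))"
      unfolding sum_nodes[OF jkl] using nz jkl by (simp add: \<kappa>_def ek_def el_def)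
    finally show "(\<Sum>a\<in>{0..3}. ln (\<sigma> (a, i)) - 1 / 2 + ((\<integral>w. (s m (a, i) w)\<^sup>2 \<partial>gnoise ?I) + 1) / (2 * (\<sigma> (a, i))\<^sup>2))
      \<le> ln T / 2 + (\<Sum>a\<in>{0..3}. \<kappa> a * ((\<integral>w. (?x m w a i)\<^sup>2 \<partial>gnoise ?I) - P))" .
  next
    show "\<sigma> t > 0" for t using T by (simp add: \<sigma>_def)
    show "\<kappa> a \<ge> 0" for a using T g by (simp add: \<kappa>_def)
    fix m m' and w w' :: "nat \<times> nat \<Rightarrow> real"
    assume mj: "m j = m' j" and sh: "shear ?I (s m) w = shear ?I (s m') w'"
    have y: "s m (a, i) w + w (a, i) = s m' (a, i) w' + w' (a, i)" if "a \<in> {0..3}" "i < n" for a i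
      using fun_cong[OF sh, of "(a, i)"] that by (simp add: shear_def)
    let ?H = "hist h1 h2 h3 c m w" and ?H' = "hist h1 h2 h3 c m' w'"
    have "i \<le> n \<Longrightarrow> ?H i 0 = ?H' i 0 \<and> ?H i j = ?H' i j \<and> ?H i l = ?H' i l" for i
    proof (induction i)
      case (Suc i)
      then have i: "i < n" and IH: "?H i 0 = ?H' i 0" "?H i j = ?H' i j" "?H i l = ?H' i l" by auto
      have wa: "w (a, i) = w' (a, i)" if "a \<in> {j, l}" for a
        using y[of a i] that i nz nodes by (auto simp: sa)
      \<comment> \<open>The inputs of \<open>k\<close> and \<open>l\<close> may differ between the
        two runs; only their noisy combination is known to agree. The input of \<open>j\<close>
        agrees by the induction hypothesis and \<open>mj\<close>, which fixes the next relay
        output.\<close>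
      have y0: "?gk * enc c k i (m k) (?H i k) + ?gl * enc c l i (m l) (?H i l) + w (0, i)
        = ?gk * enc c k i (m' k) (?H' i k) + ?gl * enc c l i (m' l) (?H' i l) + w' (0, i)"
        using y[of 0 i] i nz by (simp add: s0 inp_def)
      show ?case
        using IH wa y0 mj jkl nz by (simp add: Let_def sum_users[OF jkl])
    qed simp
    then show "?H n j = ?H' n j \<and> ?H n l = ?H' n l" by blast
  qed (rule perr)
  then show ?thesis unfolding T_def g_def .
qed

section \<open>From codes to achievable rates and the sum-capacity\<close>

lemma Cap_eq_ln: "Cap x * ln 2 = ln (1 + x) / 2"
  by (simp add: Cap_def log_def)

lemma broadcast_bound:
  assumes "achievable h1 h2 h3 P R" and "P > 0"
    and jkl: "j \<in> users" "k \<in> users" "l \<in> users" "j \<noteq> k" "j \<noteq> l" "k \<noteq> l"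
  shows "R k j + R l j + R k l \<le> Cap (((gain h1 h2 h3 j)\<^sup>2 + (gain h1 h2 h3 l)\<^sup>2) * P)"
proof -
  obtain cs where valid: "\<And>n. valid_code h1 h2 h3 P n R (cs n)"
    and perr: "(\<lambda>n. perr h1 h2 h3 n R (cs n)) \<longlonglongrightarrow> 0"
    using assms(1) by (auto simp: achievable_def)
  have "(R k j + R l j + R k l) * ln 2 \<le> ln (1 + ((gain h1 h2 h3 j)\<^sup>2 + (gain h1 h2 h3 l)\<^sup>2) * P) / 2"
    by (rule asymptotic_rate_bound[OF perr])
       (simp only: mult.assoc[symmetric] broadcast_code_bound[OF valid _ assms(2) jkl])
  then show ?thesis unfolding Cap_eq_ln[symmetric] by simp
qed

lemma multiple_access_bound:
  assumes "achievable h1 h2 h3 P R" and "P > 0"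
    and jkl: "j \<in> users" "k \<in> users" "l \<in> users" "j \<noteq> k" "j \<noteq> l" "k \<noteq> l"
  shows "R k j + R l j + R k l \<le> Cap ((\<bar>gain h1 h2 h3 k\<bar> + \<bar>gain h1 h2 h3 l\<bar>)\<^sup>2 * P)"
proof -
  obtain cs where valid: "\<And>n. valid_code h1 h2 h3 P n R (cs n)"
    and perr: "(\<lambda>n. perr h1 h2 h3 n R (cs n)) \<longlonglongrightarrow> 0"
    using assms(1) by (auto simp: achievable_def)
  have "(R k j + R l j + R k l) * ln 2 \<le> ln (1 + (\<bar>gain h1 h2 h3 k\<bar> + \<bar>gain h1 h2 h3 l\<bar>)\<^sup>2 * P) / 2"
    by (rule asymptotic_rate_bound[OF perr])
       (simp only: mult.assoc[symmetric] multiple_access_code_bound[OF valid _ assms(2) jkl])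
  then show ?thesis unfolding Cap_eq_ln[symmetric] by simp
qed

theorem theorem2:
  fixes h1 h2 h3 P :: real
  assumes "h1\<^sup>2 \<ge> h2\<^sup>2" and "h2\<^sup>2 \<ge> h3\<^sup>2" and "P > 0"
  shows "sum_capacity h1 h2 h3 P
           \<le> ereal (Cap ((h2\<^sup>2 + h3\<^sup>2) * P)
                    + Cap (min (h1\<^sup>2 + h3\<^sup>2) ((\<bar>h2\<bar> + \<bar>h3\<bar>)\<^sup>2) * P))"
  unfolding sum_capacity_def
proof (rule SUP_least)
  fix R assume "R \<in> {R. achievable h1 h2 h3 P R}"
  then have R: "achievable h1 h2 h3 P R" by simp
  have pairs: "pairs = {(1, 2), (1, 3), (3, 2), (2, 1), (3, 1), (2, 3)}"
    by (auto simp: pairs_def users_def)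
  \<comment> \<open>This triple and the one in the next two bounds together contain each of the six
    rates exactly once. Here users 2 and 3, which have the smallest gains, are the observers; the
    complementary triple has \<open>j = 1\<close> and obeys both cut bounds, hence the
    minimum.\<close>
  have "R 1 2 + R 3 2 + R 1 3 \<le> Cap ((h2\<^sup>2 + h3\<^sup>2) * P)"
    using broadcast_bound[OF R assms(3), of 2 1 3] by (simp add: users_def gain_def)
  moreover have "R 2 1 + R 3 1 + R 2 3 \<le> Cap ((h1\<^sup>2 + h3\<^sup>2) * P)"
    using broadcast_bound[OF R assms(3), of 1 2 3] by (simp add: users_def gain_def)
  moreover have "R 2 1 + R 3 1 + R 2 3 \<le> Cap ((\<bar>h2\<bar> + \<bar>h3\<bar>)\<^sup>2 * P)"
    using multiple_access_bound[OF R assms(3), of 1 2 3] by (simp add: users_def gain_def)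
  ultimately show "ereal (\<Sum>(j, k)\<in>pairs. R j k) \<le> ereal (Cap ((h2\<^sup>2 + h3\<^sup>2) * P)
      + Cap (min (h1\<^sup>2 + h3\<^sup>2) ((\<bar>h2\<bar> + \<bar>h3\<bar>)\<^sup>2) * P))"
    by (simp add: pairs min_def)
qed

end
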